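(* Let $G$ be a finite-dimensional Lie group with Lie algebra $\mathfrak g$, acting on the left by a representation on a finite-dimensional vector space $V$ and by the induced representation on $V^*$. Let $\alpha_0\in V^*$, let $G_{\alpha_0}$ be its isotropy subgroup and $\mathfrak g_{\alpha_0}$ the Lie algebra of $G_{\alpha_0}$. Assume that the smooth Hamiltonians $H_{\alpha_0},H_{i,\alpha_0}:T^*G\to\mathbb R$, $i=1,\dots,N$, are left $G_{\alpha_0}$-invariant (under the cotangent lift of left translation), so that they are given by reduced Hamiltonians $h,h_i:\mathfrak g^*\times\mathrm{Orb}(\alpha_0)\to\mathbb R$ via $H_{\alpha_0}(g,p)=h(g^{-1}p,g^{-1}\cdot\alpha_0)$ and $H_{i,\alpha_0}(g,p)=h_i(g^{-1}p,g^{-1}\cdot\alpha_0)$. Then the discrete momentum map is $$J(g_k,p_k)=i_{\alpha_0}^*(p_kg_k^{-1})\in\mathfrak g_{\alpha_0}^*,$$ where $i_{\alpha_0}^*:\mathfrak g^*\to\mathfrak g_{\alpha_0}^*$ is the dual of the Lie algebra inclusion, and it is preserved by the discrete stochastic flow determined by the stochastic midpoint integrator with advected parameter (described in the context).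
   Context: Conventions. $\langle g\cdot\alpha,v\rangle=\langle\alpha,g^{-1}\cdot v\rangle$ for $\alpha\in V^*$, $v\in V$; $\mathrm{Orb}(\alpha_0)$ is the $G$-orbit of $\alpha_0$. The diamond operation $\diamond:V\times V^*\to\mathfrak g^*$ is $\langle v\diamond\alpha,\xi\rangle=-\langle v,\xi\cdot\alpha\rangle=\langle\xi\cdot v,\alpha\rangle$. A retraction map $\tau:\mathfrak g\to G$ is a local diffeomorphism (near $0$) with $\tau(0)=e$. For $\xi,\eta\in\mathfrak g$, $g=\tau(\xi)$: $\mathrm d_\xi\tau^{-1}(\eta):=\mathrm D\tau^{-1}(g)\cdot(\eta g)$, with dual $[\mathrm d_\xi\tau^{-1}]^*$. $\langle\mathrm{Ad}^*_g\mu,\eta\rangle=\langle\mu,\mathrm{Ad}_g\eta\rangle$. For $p\in T_g^*G$, $g^{-1}p,\,pg^{-1}\in\mathfrak g^*$ are the left and right translates; $g\mu\in T_g^*G$ is the left translate of $\mu\in\mathfrak g^*$. The momentum map of the cotangent-lifted left translation of a subgroup with Lie algebra $\mathfrak k$ is $\langle J(g,p),\zeta\rangle=\langle p,\zeta g\rangle$, $\zeta\in\mathfrak k$. $\partial h/\partial\alpha\in V$ is the derivative of any smooth extension of $h$ to $\mathfrak g^*\times V^*$; $\frac{\partial h}{\partial\alpha}\diamond\alpha$ does not depend on the extension. Scheme. Fix a retraction map $\tau$. Let $\Delta t>0$, $M\ge1$, $T=M\Delta t$, $\Delta W^i_k$ ($k=1,\dots,M$) the increments of independent Wiener processes over the $k$-th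 step (everything is pathwise), and $\mathsf h_k:=h+\sum_{i=1}^Nh_i\,\Delta W^i_k/\Delta t$. The unknowns are $g_k,\tilde g_k\in G$ and $\tilde\mu_k^1,\tilde\mu_k^2\in\mathfrak g^*$. With $\tilde\alpha_k=\tilde g_k^{-1}\cdot\alpha_0$, $\Delta t\,\xi_k=\tau^{-1}(\tilde g_k^{-1}g_k)$, $\Delta t\,\tilde\xi_k=\tau^{-1}(g_{k-1}^{-1}\tilde g_k)$ and derivatives of $\mathsf h_k$ evaluated at $(\frac{\tilde\mu_k^1+\tilde\mu_k^2}2,\tilde\alpha_k)$, the integrator is $$\tfrac1{\Delta t}\big(\mathrm{Ad}^*_{\tau(\Delta t\tilde\xi_k)}[\mathrm d_{\Delta t\tilde\xi_k}\tau^{-1}]^*\tilde\mu^1_k-[\mathrm d_{\Delta t\xi_k}\tau^{-1}]^*\tilde\mu^2_k\big)=\tfrac{\partial\mathsf h_k}{\partial\alpha}\diamond\tilde\alpha_k,\qquad\tilde\xi_k=\xi_k=\tfrac12\tfrac{\partial\mathsf h_k}{\partial\mu}\quad(k=1,\dots,M),$$ $$\mathrm{Ad}^*_{\tau(\Delta t\xi_k)}[\mathrm d_{\Delta t\xi_k}\tau^{-1}]^*\tilde\mu^2_k=[\mathrm d_{\Delta t\tilde\xi_{k+1}}\tau^{-1}]^*\tilde\mu^1_{k+1}\quad(k=1,\dots,M-1).$$ The momenta $p_k\in T^*_{g_k}G$ are $p_k=g_k[\mathrm d_{\Delta t\tilde\xi_{k+1}}\tau^{-1}]^*\tilde\mu^1_{k+1}$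 for $0\le k\le M-1$ and $p_k=g_k\mathrm{Ad}^*_{\tau(\Delta t\xi_k)}[\mathrm d_{\Delta t\xi_k}\tau^{-1}]^*\tilde\mu^2_k$ for $1\le k\le M$ (the two agree when both apply). Standing assumption: the implicit equations are solvable with all arguments of $\tau^{-1}$ in its domain, so that the discrete flow $(g_0,p_0)\mapsto(g_k,p_k)$ is defined. *)

theory Defs
  imports "HOL-Probability.Probability" "HOL-Algebra.Group_Action"
begin

text \<open>Only meaningful for an open set \<open>S\<close>. All spaces to which this is applied are finite-dimensional,
  where it says that \<open>f\<close> is \<open>n\<close> times continuously differentiable on \<open>S\<close>.\<close>

fun higher_differentiable_on ::
  "'a::real_normed_vector set \<Rightarrow> ('a \<Rightarrow> 'b::real_normed_vector) \<Rightarrow> nat \<Rightarrow> bool" where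
  "higher_differentiable_on S f 0 \<longleftrightarrow> continuous_on S f"
| "higher_differentiable_on S f (Suc n) \<longleftrightarrow>
     (\<forall>x\<in>S. f differentiable (at x)) \<and>
     (\<forall>v. higher_differentiable_on S (\<lambda>x. frechet_derivative f (at x) v) n)"

definition smooth_on ::
  "'a::real_normed_vector set \<Rightarrow> ('a \<Rightarrow> 'b::real_normed_vector) \<Rightarrow> bool" where
  "smooth_on S f \<longleftrightarrow> (\<forall>n. higher_differentiable_on S f n)"

text \<open>Finite dimension is stated as a condition on a normed space rather than through the class
  \<open>euclidean_space\<close>, because the latter excludes dimension \<open>0\<close>. On a finite-dimensional normed space
  every linear functional is bounded, so that \<open>'v \<Rightarrow>\<^sub>L real\<close> is the algebraic dual.\<close>

definition finite_dimensional :: "'v::real_normed_vector itself \<Rightarrow> bool" where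
  "finite_dimensional _ \<longleftrightarrow> (\<exists>B::'v set. finite B \<and> span B = UNIV)"

type_synonym ('m, 'e) atlas = "('m set \<times> ('m \<Rightarrow> 'e)) set"

definition smooth_atlas ::
  "('m::{t2_space,second_countable_topology}, 'e::real_normed_vector) atlas \<Rightarrow> bool" where
  "smooth_atlas A \<longleftrightarrow>
     finite_dimensional TYPE('e) \<and>
     \<Union>(fst ` A) = UNIV \<and>
     (\<forall>(U, \<phi>)\<in>A. open U \<and> open (\<phi> ` U) \<and> homeomorphism U (\<phi> ` U) \<phi> (inv_into U \<phi>)) \<and>
     (\<forall>(U, \<phi>)\<in>A. \<forall>(V, \<psi>)\<in>A. smooth_on (\<phi> ` (U \<inter> V)) (\<psi> \<circ> inv_into U \<phi>))"

definition vec_atlas :: "('e::real_normed_vector, 'e) atlas" where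
  "vec_atlas = {(UNIV, id)}"

definition prod_atlas ::
  "('m, 'e) atlas \<Rightarrow> ('n, 'f) atlas \<Rightarrow> ('m \<times> 'n, 'e \<times> 'f) atlas" where
  "prod_atlas A B = {(U \<times> V, map_prod \<phi> \<psi>) | U \<phi> V \<psi>. (U, \<phi>) \<in> A \<and> (V, \<psi>) \<in> B}"

definition smooth_map ::
  "('m::topological_space, 'e::real_normed_vector) atlas \<Rightarrow>
   ('n::topological_space, 'f::real_normed_vector) atlas \<Rightarrow> 'm set \<Rightarrow> ('m \<Rightarrow> 'n) \<Rightarrow> bool" where
  "smooth_map A B S f \<longleftrightarrow>
     continuous_on S f \<and>
     (\<forall>(U, \<phi>)\<in>A. \<forall>(V, \<psi>)\<in>B. smooth_on (\<phi> ` (S \<inter> U \<inter> f -` V)) (\<psi> \<circ> f \<circ> inv_into U \<phi>))"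

text \<open>Every point \<open>x\<close> gets a preferred chart, and the tangent space at \<open>x\<close> is realised as the model
  space \<open>'e\<close>, a vector standing for its coordinates in the preferred chart at \<open>x\<close>. Accordingly
  cotangent vectors at \<open>x\<close> are elements of \<open>'e \<Rightarrow>\<^sub>L real\<close>. In \<open>vec_atlas\<close> this is the usual
  identification of a vector space with its tangent spaces.\<close>

definition chart_at :: "('m, 'e) atlas \<Rightarrow> 'm \<Rightarrow> 'm set \<times> ('m \<Rightarrow> 'e)" where
  "chart_at A x = (SOME c. c \<in> A \<and> x \<in> fst c)"

definition coord :: "('m, 'e) atlas \<Rightarrow> 'm \<Rightarrow> 'm \<Rightarrow> 'e" where
  "coord A x = snd (chart_at A x)"

definition coord_inv :: "('m, 'e) atlas \<Rightarrow> 'm \<Rightarrow> 'e \<Rightarrow> 'm" where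
  "coord_inv A x = inv_into (fst (chart_at A x)) (coord A x)"

definition tangent_map ::
  "('m, 'e::real_normed_vector) atlas \<Rightarrow> ('n, 'f::real_normed_vector) atlas \<Rightarrow>
   ('m \<Rightarrow> 'n) \<Rightarrow> 'm \<Rightarrow> 'e \<Rightarrow>\<^sub>L 'f" where
  "tangent_map A B f x =
     Blinfun (frechet_derivative (coord B (f x) \<circ> f \<circ> coord_inv A x) (at (coord A x x)))"

text \<open>Smoothness of a function on the cotangent bundle, in the bundle charts
  \<open>(g, p) \<mapsto> (\<phi> g, p \<circ> (T\<^sub>g \<phi>)\<inverse>)\<close> induced by the charts \<open>\<phi>\<close> of the base.\<close>

definition smooth_on_cotangent_bundle ::
  "('m, 'e::real_normed_vector) atlas \<Rightarrow> ('m \<times> ('e \<Rightarrow>\<^sub>L real) \<Rightarrow> real) \<Rightarrow> bool" where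
  "smooth_on_cotangent_bundle A H \<longleftrightarrow>
     (\<forall>(U, \<phi>)\<in>A. smooth_on (\<phi> ` U \<times> UNIV)
        (\<lambda>(x, q). H (inv_into U \<phi> x, q o\<^sub>L tangent_map A vec_atlas \<phi> (inv_into U \<phi> x))))"

record ('g, 'e) lie_data = "'g monoid" +
  atlas :: "('g, 'e) atlas"

locale lie_group = group G
  for G :: "('g::{t2_space,second_countable_topology}, 'e::real_normed_vector) lie_data" (structure) +
  assumes carrier_UNIV: "carrier G = UNIV"
    and smooth_atlas: "smooth_atlas (atlas G)"
    and smooth_mult: "smooth_map (prod_atlas (atlas G) (atlas G)) (atlas G) UNIV (\<lambda>(x, y). x \<otimes> y)"
    and smooth_inv: "smooth_map (atlas G) (atlas G) UNIV (m_inv G)"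

text \<open>The Lie algebra of \<open>G\<close> is the tangent space at the identity, hence \<open>'e\<close>.\<close>

text \<open>\<open>tangent_left G a g\<close> is the map \<open>v \<mapsto> a v\<close> from \<open>T\<^sub>g G\<close> to the tangent space at \<open>a g\<close>;
  \<open>tangent_right G a g\<close> is the map \<open>v \<mapsto> v a\<close> from \<open>T\<^sub>g G\<close> to the tangent space at \<open>g a\<close>.\<close>

definition tangent_left :: "('g, 'e::real_normed_vector) lie_data \<Rightarrow> 'g \<Rightarrow> 'g \<Rightarrow> 'e \<Rightarrow>\<^sub>L 'e" where
  "tangent_left G a g = tangent_map (atlas G) (atlas G) (\<lambda>x. a \<otimes>\<^bsub>G\<^esub> x) g"

definition tangent_right :: "('g, 'e::real_normed_vector) lie_data \<Rightarrow> 'g \<Rightarrow> 'g \<Rightarrow> 'e \<Rightarrow>\<^sub>L 'e" where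
  "tangent_right G a g = tangent_map (atlas G) (atlas G) (\<lambda>x. x \<otimes>\<^bsub>G\<^esub> a) g"

text \<open>\<open>cotangent_left G a g p\<close> is \<open>a p\<close>, the cotangent lift of left translation by \<open>a\<close> applied to
  the cotangent vector \<open>p\<close> at \<open>g\<close>; it is a cotangent vector at \<open>a g\<close>, with
  \<open>\<langle>a p, v\<rangle> = \<langle>p, a\<inverse> v\<rangle>\<close>. Similarly \<open>cotangent_right G a g p\<close> is \<open>p a\<close>, a cotangent vector at \<open>g a\<close>.\<close>

definition cotangent_left ::
  "('g, 'e::real_normed_vector) lie_data \<Rightarrow> 'g \<Rightarrow> 'g \<Rightarrow> ('e \<Rightarrow>\<^sub>L real) \<Rightarrow> ('e \<Rightarrow>\<^sub>L real)" where
  "cotangent_left G a g p = p o\<^sub>L tangent_left G (inv\<^bsub>G\<^esub> a) (a \<otimes>\<^bsub>G\<^esub> g)"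

definition cotangent_right ::
  "('g, 'e::real_normed_vector) lie_data \<Rightarrow> 'g \<Rightarrow> 'g \<Rightarrow> ('e \<Rightarrow>\<^sub>L real) \<Rightarrow> ('e \<Rightarrow>\<^sub>L real)" where
  "cotangent_right G a g p = p o\<^sub>L tangent_right G (inv\<^bsub>G\<^esub> a) (g \<otimes>\<^bsub>G\<^esub> a)"

definition Ad :: "('g, 'e::real_normed_vector) lie_data \<Rightarrow> 'g \<Rightarrow> 'e \<Rightarrow>\<^sub>L 'e" where
  "Ad G g = tangent_map (atlas G) (atlas G) (\<lambda>x. g \<otimes>\<^bsub>G\<^esub> x \<otimes>\<^bsub>G\<^esub> inv\<^bsub>G\<^esub> g) \<one>\<^bsub>G\<^esub>"

definition Ad_star ::
  "('g, 'e::real_normed_vector) lie_data \<Rightarrow> 'g \<Rightarrow> ('e \<Rightarrow>\<^sub>L real) \<Rightarrow> ('e \<Rightarrow>\<^sub>L real)" where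
  "Ad_star G g \<mu> = \<mu> o\<^sub>L Ad G g"

text \<open>The Lie algebra of a closed subgroup \<open>H\<close>, as a subspace of the Lie algebra of \<open>G\<close>: the tangent
  space at the identity of the embedded submanifold \<open>H\<close>, that is, the velocities of the smooth
  curves of \<open>G\<close> that lie in \<open>H\<close> and start at the identity.\<close>

definition lie_subalgebra ::
  "('g::topological_space, 'e::real_normed_vector) lie_data \<Rightarrow> 'g set \<Rightarrow> 'e set" where
  "lie_subalgebra G H =
     {blinfun_apply (tangent_map vec_atlas (atlas G) c 0) 1 | c :: real \<Rightarrow> 'g.
        smooth_map vec_atlas (atlas G) UNIV c \<and> c 0 = \<one>\<^bsub>G\<^esub> \<and> range c \<subseteq> H}"

text \<open>The dual of a subspace \<open>\<kk>\<close>; functionals are extensional outside \<open>\<kk>\<close>.\<close>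

definition dual_space :: "'e::real_vector set \<Rightarrow> ('e \<Rightarrow> real) set" where
  "dual_space \<kk> = {f \<in> extensional \<kk>.
     (\<forall>x\<in>\<kk>. \<forall>y\<in>\<kk>. f (x + y) = f x + f y) \<and> (\<forall>c. \<forall>x\<in>\<kk>. f (c *\<^sub>R x) = c * f x)}"

definition inclusion_dual :: "'e::real_normed_vector set \<Rightarrow> ('e \<Rightarrow>\<^sub>L real) \<Rightarrow> ('e \<Rightarrow> real)" where
  "inclusion_dual \<kk> \<mu> = (\<lambda>\<zeta>\<in>\<kk>. blinfun_apply \<mu> \<zeta>)"

text \<open>The momentum map of the cotangent-lifted left translation of a subgroup with Lie algebra \<open>\<kk>\<close>:
  \<open>\<langle>J (g, p), \<zeta>\<rangle> = \<langle>p, \<zeta> g\<rangle>\<close>.\<close>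

definition momentum_map ::
  "('g, 'e::real_normed_vector) lie_data \<Rightarrow> 'e set \<Rightarrow> 'g \<times> ('e \<Rightarrow>\<^sub>L real) \<Rightarrow> ('e \<Rightarrow> real)" where
  "momentum_map G \<kk> = (\<lambda>(g, p). \<lambda>\<zeta>\<in>\<kk>. blinfun_apply p (tangent_right G g \<one>\<^bsub>G\<^esub> \<zeta>))"

text \<open>\<open>U\<close> is the neighbourhood of \<open>0\<close> on which \<open>\<tau>\<close> is a diffeomorphism; its inverse there is
  \<open>inv_into U \<tau>\<close>, with domain \<open>\<tau> ` U\<close>.\<close>

definition lie_retraction ::
  "('g::topological_space, 'e::real_normed_vector) lie_data \<Rightarrow> ('e \<Rightarrow> 'g) \<Rightarrow> 'e set \<Rightarrow> bool" where
  "lie_retraction G \<tau> U \<longleftrightarrow>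
     \<tau> 0 = \<one>\<^bsub>G\<^esub> \<and> open U \<and> 0 \<in> U \<and> open (\<tau> ` U) \<and> inj_on \<tau> U \<and>
     smooth_map vec_atlas (atlas G) U \<tau> \<and> smooth_map (atlas G) vec_atlas (\<tau> ` U) (inv_into U \<tau>)"

definition dtau_inv ::
  "('g, 'e::real_normed_vector) lie_data \<Rightarrow> ('e \<Rightarrow> 'g) \<Rightarrow> 'e set \<Rightarrow> 'e \<Rightarrow> 'e \<Rightarrow>\<^sub>L 'e" where
  "dtau_inv G \<tau> U \<xi> =
     tangent_map (atlas G) vec_atlas (inv_into U \<tau>) (\<tau> \<xi>) o\<^sub>L tangent_right G (\<tau> \<xi>) \<one>\<^bsub>G\<^esub>"

definition dtau_inv_dual ::
  "('g, 'e::real_normed_vector) lie_data \<Rightarrow> ('e \<Rightarrow> 'g) \<Rightarrow> 'e set \<Rightarrow> 'e \<Rightarrow>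
   ('e \<Rightarrow>\<^sub>L real) \<Rightarrow> ('e \<Rightarrow>\<^sub>L real)" where
  "dtau_inv_dual G \<tau> U \<xi> \<mu> = \<mu> o\<^sub>L dtau_inv G \<tau> U \<xi>"

definition lie_representation ::
  "('g::topological_space, 'e::real_normed_vector) lie_data \<Rightarrow>
   ('g \<Rightarrow> 'v::real_normed_vector \<Rightarrow> 'v) \<Rightarrow> bool" where
  "lie_representation G \<rho> \<longleftrightarrow>
     finite_dimensional TYPE('v) \<and> group_action G UNIV \<rho> \<and> (\<forall>g\<in>carrier G. linear (\<rho> g)) \<and>
     smooth_map (prod_atlas (atlas G) vec_atlas) vec_atlas UNIV (\<lambda>(g, v). \<rho> g v)"

definition dual_action ::
  "('g, 'e) lie_data \<Rightarrow> ('g \<Rightarrow> 'v::real_normed_vector \<Rightarrow> 'v) \<Rightarrow>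
   'g \<Rightarrow> ('v \<Rightarrow>\<^sub>L real) \<Rightarrow> ('v \<Rightarrow>\<^sub>L real)" where
  "dual_action G \<rho> g \<alpha> = \<alpha> o\<^sub>L Blinfun (\<rho> (inv\<^bsub>G\<^esub> g))"

definition infinitesimal_action ::
  "('g, 'e::real_normed_vector) lie_data \<Rightarrow> ('g \<Rightarrow> 'v::real_normed_vector \<Rightarrow> 'v) \<Rightarrow>
   'v \<Rightarrow> 'e \<Rightarrow>\<^sub>L 'v" where
  "infinitesimal_action G \<rho> v = tangent_map (atlas G) vec_atlas (\<lambda>g. \<rho> g v) \<one>\<^bsub>G\<^esub>"

text \<open>\<open>\<langle>v \<diamond> \<alpha>, \<xi>\<rangle> = \<langle>\<xi> \<cdot> v, \<alpha>\<rangle>\<close>, where \<open>\<xi> \<cdot> v\<close> is \<open>infinitesimal_action G \<rho> v \<xi>\<close>.\<close>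

definition diamond ::
  "('g, 'e::real_normed_vector) lie_data \<Rightarrow> ('g \<Rightarrow> 'v::real_normed_vector \<Rightarrow> 'v) \<Rightarrow>
   'v \<Rightarrow> ('v \<Rightarrow>\<^sub>L real) \<Rightarrow> ('e \<Rightarrow>\<^sub>L real)" where
  "diamond G \<rho> v \<alpha> = \<alpha> o\<^sub>L infinitesimal_action G \<rho> v"

text \<open>For a function on a dual space the derivative at a point is identified with a vector, by
  reflexivity of finite-dimensional spaces.\<close>

definition dual_gradient :: "(('v::real_normed_vector \<Rightarrow>\<^sub>L real) \<Rightarrow> real) \<Rightarrow> ('v \<Rightarrow>\<^sub>L real) \<Rightarrow> 'v" where
  "dual_gradient f \<alpha> = (THE v. (f has_derivative (\<lambda>\<delta>. blinfun_apply \<delta> v)) (at \<alpha>))"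

definition d_mu ::
  "(('e::real_normed_vector \<Rightarrow>\<^sub>L real) \<times> ('v::real_normed_vector \<Rightarrow>\<^sub>L real) \<Rightarrow> real) \<Rightarrow>
   ('e \<Rightarrow>\<^sub>L real) \<times> ('v \<Rightarrow>\<^sub>L real) \<Rightarrow> 'e" where
  "d_mu f = (\<lambda>(\<mu>, \<alpha>). dual_gradient (\<lambda>m. f (m, \<alpha>)) \<mu>)"

definition d_alpha ::
  "(('e::real_normed_vector \<Rightarrow>\<^sub>L real) \<times> ('v::real_normed_vector \<Rightarrow>\<^sub>L real) \<Rightarrow> real) \<Rightarrow>
   ('e \<Rightarrow>\<^sub>L real) \<times> ('v \<Rightarrow>\<^sub>L real) \<Rightarrow> 'v" where
  "d_alpha f = (\<lambda>(\<mu>, \<alpha>). dual_gradient (\<lambda>a. f (\<mu>, a)) \<alpha>)"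

definition left_invariant ::
  "('g, 'e::real_normed_vector) lie_data \<Rightarrow> 'g set \<Rightarrow> ('g \<times> ('e \<Rightarrow>\<^sub>L real) \<Rightarrow> real) \<Rightarrow> bool" where
  "left_invariant G K H \<longleftrightarrow>
     (\<forall>a\<in>K. \<forall>g\<in>carrier G. \<forall>p. H (a \<otimes>\<^bsub>G\<^esub> g, cotangent_left G a g p) = H (g, p))"

text \<open>\<open>H (g, p) = h (g\<inverse> p, g\<inverse> \<cdot> \<alpha>\<^sub>0)\<close>; only the values of \<open>h\<close> on the product of the dual Lie
  algebra with the orbit of \<open>\<alpha>\<^sub>0\<close> are involved.\<close>

definition is_reduced_hamiltonian ::
  "('g, 'e::real_normed_vector) lie_data \<Rightarrow> ('g \<Rightarrow> 'v::real_normed_vector \<Rightarrow> 'v) \<Rightarrow> ('v \<Rightarrow>\<^sub>L real) \<Rightarrow>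
   ('g \<times> ('e \<Rightarrow>\<^sub>L real) \<Rightarrow> real) \<Rightarrow> (('e \<Rightarrow>\<^sub>L real) \<times> ('v \<Rightarrow>\<^sub>L real) \<Rightarrow> real) \<Rightarrow> bool" where
  "is_reduced_hamiltonian G \<rho> \<alpha>\<^sub>0 H h \<longleftrightarrow>
     (\<forall>g\<in>carrier G. \<forall>p.
        H (g, p) = h (cotangent_left G (inv\<^bsub>G\<^esub> g) g p, dual_action G \<rho> (inv\<^bsub>G\<^esub> g) \<alpha>\<^sub>0))"

definition smooth_extension ::
  "'a::real_normed_vector set \<Rightarrow> ('a \<Rightarrow> real) \<Rightarrow> ('a \<Rightarrow> real) \<Rightarrow> bool" where
  "smooth_extension S f F \<longleftrightarrow> smooth_on UNIV F \<and> (\<forall>x\<in>S. F x = f x)"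

definition wiener_process :: "'w measure \<Rightarrow> (real \<Rightarrow> 'w \<Rightarrow> real) \<Rightarrow> bool" where
  "wiener_process P B \<longleftrightarrow>
     prob_space P \<and>
     (\<forall>t\<ge>0. B t \<in> borel_measurable P) \<and>
     (AE \<omega> in P. B 0 \<omega> = 0) \<and>
     (AE \<omega> in P. continuous_on {0..} (\<lambda>t. B t \<omega>)) \<and>
     (\<forall>s t. 0 \<le> s \<longrightarrow> s < t \<longrightarrow>
        distributed P lborel (\<lambda>\<omega>. B t \<omega> - B s \<omega>) (normal_density 0 (sqrt (t - s)))) \<and>
     (\<forall>n (t :: nat \<Rightarrow> real). 0 \<le> t 0 \<longrightarrow> (\<forall>j<n. t j < t (Suc j)) \<longrightarrow>
        prob_space.indep_vars P (\<lambda>_. borel) (\<lambda>j \<omega>. B (t (Suc j)) \<omega> - B (t j) \<omega>) {..<n})"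

definition independent_wiener_processes ::
  "'w measure \<Rightarrow> nat \<Rightarrow> (nat \<Rightarrow> real \<Rightarrow> 'w \<Rightarrow> real) \<Rightarrow> bool" where
  "independent_wiener_processes P N W \<longleftrightarrow>
     prob_space P \<and> (\<forall>i\<in>{1..N}. wiener_process P (W i)) \<and>
     prob_space.indep_vars P (\<lambda>_. PiM {0..} (\<lambda>_. borel)) (\<lambda>i \<omega>. \<lambda>t\<in>{0..}. W i t \<omega>) {1..N}"

definition step_hamiltonian ::
  "('x \<Rightarrow> real) \<Rightarrow> nat \<Rightarrow> (nat \<Rightarrow> 'x \<Rightarrow> real) \<Rightarrow> (nat \<Rightarrow> real \<Rightarrow> 'w \<Rightarrow> real) \<Rightarrow> real \<Rightarrow> 'w \<Rightarrow>
   nat \<Rightarrow> 'x \<Rightarrow> real" where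
  "step_hamiltonian h N hs W \<Delta>t \<omega> k x =
     h x + (\<Sum>i=1..N. hs i x * ((W i (real k * \<Delta>t) \<omega> - W i (real (k - 1) * \<Delta>t) \<omega>) / \<Delta>t))"

text \<open>The sequences \<open>g\<close>, \<open>gt\<close>, \<open>\<mu>1\<close>, \<open>\<mu>2\<close>, \<open>\<xi>\<close>, \<open>\<xi>t\<close>, \<open>p\<close> solve the scheme with step Hamiltonians
  \<open>F k\<close>; a suffix \<open>t\<close> stands for a tilde.\<close>

locale midpoint_trajectory =
  fixes G :: "('g, 'e::real_normed_vector) lie_data" (structure)
    and \<rho> :: "'g \<Rightarrow> 'v::real_normed_vector \<Rightarrow> 'v"
    and \<alpha>\<^sub>0 :: "'v \<Rightarrow>\<^sub>L real"
    and \<tau> :: "'e \<Rightarrow> 'g" and U :: "'e set"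
    and \<Delta>t :: real and M :: nat
    and F :: "nat \<Rightarrow> ('e \<Rightarrow>\<^sub>L real) \<times> ('v \<Rightarrow>\<^sub>L real) \<Rightarrow> real"
    and g gt :: "nat \<Rightarrow> 'g"
    and \<mu>1 \<mu>2 :: "nat \<Rightarrow> ('e \<Rightarrow>\<^sub>L real)"
    and \<xi> \<xi>t :: "nat \<Rightarrow> 'e"
    and p :: "nat \<Rightarrow> ('e \<Rightarrow>\<^sub>L real)"
  assumes in_carrier: "k \<le> M \<Longrightarrow> g k \<in> carrier G" "k \<in> {1..M} \<Longrightarrow> gt k \<in> carrier G"
    and xi: "k \<in> {1..M} \<Longrightarrow> inv (gt k) \<otimes> g k \<in> \<tau> ` U"
      "k \<in> {1..M} \<Longrightarrow> \<Delta>t *\<^sub>R \<xi> k = inv_into U \<tau> (inv (gt k) \<otimes> g k)"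
    and xit: "k \<in> {1..M} \<Longrightarrow> inv (g (k - 1)) \<otimes> gt k \<in> \<tau> ` U"
      "k \<in> {1..M} \<Longrightarrow> \<Delta>t *\<^sub>R \<xi>t k = inv_into U \<tau> (inv (g (k - 1)) \<otimes> gt k)"
    and momentum_eq: "k \<in> {1..M} \<Longrightarrow>
      (1 / \<Delta>t) *\<^sub>R (Ad_star G (\<tau> (\<Delta>t *\<^sub>R \<xi>t k)) (dtau_inv_dual G \<tau> U (\<Delta>t *\<^sub>R \<xi>t k) (\<mu>1 k))
                 - dtau_inv_dual G \<tau> U (\<Delta>t *\<^sub>R \<xi> k) (\<mu>2 k))
      = diamond G \<rho> (d_alpha (F k) ((1/2) *\<^sub>R (\<mu>1 k + \<mu>2 k), dual_action G \<rho> (inv (gt k)) \<alpha>\<^sub>0))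
                    (dual_action G \<rho> (inv (gt k)) \<alpha>\<^sub>0)"
    and velocity_eq: "k \<in> {1..M} \<Longrightarrow> \<xi>t k = \<xi> k"
      "k \<in> {1..M} \<Longrightarrow>
        \<xi> k = (1/2) *\<^sub>R d_mu (F k) ((1/2) *\<^sub>R (\<mu>1 k + \<mu>2 k), dual_action G \<rho> (inv (gt k)) \<alpha>\<^sub>0)"
    and matching_eq: "k \<in> {1..M - 1} \<Longrightarrow>
      Ad_star G (\<tau> (\<Delta>t *\<^sub>R \<xi> k)) (dtau_inv_dual G \<tau> U (\<Delta>t *\<^sub>R \<xi> k) (\<mu>2 k))
      = dtau_inv_dual G \<tau> U (\<Delta>t *\<^sub>R \<xi>t (k + 1)) (\<mu>1 (k + 1))"
    and p_before: "k \<in> {0..M - 1} \<Longrightarrow>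
      p k = cotangent_left G (g k) \<one> (dtau_inv_dual G \<tau> U (\<Delta>t *\<^sub>R \<xi>t (k + 1)) (\<mu>1 (k + 1)))"
    and p_after: "k \<in> {1..M} \<Longrightarrow>
      p k = cotangent_left G (g k) \<one>
              (Ad_star G (\<tau> (\<Delta>t *\<^sub>R \<xi> k)) (dtau_inv_dual G \<tau> U (\<Delta>t *\<^sub>R \<xi> k) (\<mu>2 k)))"

end

theory Submission
  imports Defs
begin

text \<open>
  In the body frame the momentum map reads \<open>\<langle>J (a, a \<nu>), \<zeta>\<rangle> = \<langle>\<nu>, Ad a\<inverse> \<zeta>\<rangle>\<close>
  (\<open>momentum_map_left_translate\<close>). Let \<open>a = g\<^sub>k\<close>, let \<open>b\<close> be the intermediate point and
  \<open>c = g\<^sub>k\<^sub>+\<^sub>1\<close>, so that the two increments of the scheme are \<open>a\<inverse> b\<close> and \<open>b\<inverse> c\<close>. Since \<open>Ad\<close> is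
  multiplicative, the coadjoint transports in the scheme bring both \<open>J (g\<^sub>k, p\<^sub>k)\<close> and
  \<open>J (g\<^sub>k\<^sub>+\<^sub>1, p\<^sub>k\<^sub>+\<^sub>1)\<close> to the same argument \<open>Ad b\<inverse> \<zeta>\<close>, and the momentum equation of the step turns
  their difference into \<open>\<Delta>t \<langle>v \<diamond> b\<inverse>\<cdot>\<alpha>\<^sub>0, Ad b\<inverse> \<zeta>\<rangle>\<close>, where \<open>v\<close> is the derivative of the step
  Hamiltonian with respect to the advected parameter. By equivariance of the infinitesimal action
  this is \<open>\<Delta>t \<langle>\<zeta>\<cdot>(b v), \<alpha>\<^sub>0\<rangle>\<close> (\<open>diamond_dual_action_Ad\<close>), the derivative of
  \<open>\<langle>\<gamma>(t) b v, \<alpha>\<^sub>0\<rangle>\<close> along a curve \<open>\<gamma>\<close> in the isotropy group with velocity \<open>\<zeta>\<close>. That function of \<open>t\<close>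
  is constant, so the difference vanishes (\<open>infinitesimal_action_annihilated\<close>). The argument holds for
  an arbitrary vector \<open>v\<close>, hence for every realisation of the noise.

  All the identities between tangent maps come from one chain rule (\<open>tangent_map_compose\<close>).

  That the momentum lies in the dual of the isotropy algebra requires this set of
  velocities to be a linear subspace. A multiple of a velocity is the velocity of a rescaled curve,
  and a sum of velocities is the velocity of the pointwise product of the curves, because the
  derivative of the multiplication at the identity is addition. The product curve must be smooth to
  all orders, which calls for the composition rule \<open>higher_differentiable_on_compose\<close>; its
  induction expands the inner derivative in coordinates, whose continuity is where
  finite-dimensionality enters.
\<close>

section \<open>Linear maps on finite-dimensional normed spaces\<close>

text \<open>The coefficient \<open>c\<close> is controlled by the distance of \<open>b\<close> from \<open>S\<close>, which is positive as \<open>S\<close> is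
  closed: dividing by \<open>c \<noteq> 0\<close>, the vector \<open>c b + s\<close> has norm at least \<open>\<bar>c\<bar>\<close> times that distance.\<close>

lemma coefficient_bounded:
  fixes b :: "'v::real_normed_vector"
  assumes "closed S" "subspace S" "b \<notin> S"
  obtains K where "\<And>c s. s \<in> S \<Longrightarrow> \<bar>c\<bar> \<le> K * norm (c *\<^sub>R b + s)"
proof -
  define d where "d = infdist b S"
  have S0: "0 \<in> S"
    using assms by (simp add: subspace_0)
  have d: "d > 0"
    unfolding d_def using assms S0 by (intro infdist_pos_not_in_closed) auto
  have "\<bar>c\<bar> \<le> (1 / d) * norm (c *\<^sub>R b + s)" if s: "s \<in> S" for c s
  proof (cases "c = 0")
    case False
    have "- (s /\<^sub>R c) \<in> S"
      using assms s by (simp add: subspace_neg subspace_scale)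
    then have "d \<le> norm (b + s /\<^sub>R c)"
      unfolding d_def using infdist_le[of "- (s /\<^sub>R c)" S b] by (simp add: dist_norm)
    then have "\<bar>c\<bar> * d \<le> norm (c *\<^sub>R (b + s /\<^sub>R c))"
      by (simp add: mult_left_mono)
    also have "c *\<^sub>R (b + s /\<^sub>R c) = c *\<^sub>R b + s"
      using False by (simp add: scaleR_add_right)
    finally show ?thesis
      using d by (simp add: field_simps)
  qed (use d in simp)
  then show ?thesis
    by (rule that)
qed

text \<open>Adding a vector \<open>b\<close> to the spanning set, the coefficients of \<open>b\<close> along a Cauchy sequence form a
  Cauchy sequence of reals by \<open>coefficient_bounded\<close>, so the remainders do so in the smaller span.
  Completeness serves to make the span closed, which lets the induction continue.\<close>

lemma complete_finite_span:
  fixes B :: "'v::real_normed_vector set"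
  assumes "finite B"
  shows "uniform_space_class.complete (span B)"
  using assms
proof induction
  case empty
  have "uniform_space_class.complete {0::'v}"
    by (intro compact_imp_complete compact_sing)
  then show ?case by (simp only: span_empty)
next
  case (insert b B)
  show ?case
  proof (cases "b \<in> span B")
    case True
    then show ?thesis
      using insert by (simp add: span_redundant)
  next
    case False
    obtain K where K: "\<And>c s. s \<in> span B \<Longrightarrow> \<bar>c\<bar> \<le> K * norm (c *\<^sub>R b + s)"
      using coefficient_bounded[OF complete_imp_closed[OF insert.IH] subspace_span False] by blast
    show ?thesis
    proof (rule completeI)
      fix f :: "nat \<Rightarrow> 'v"
      assume f: "\<forall>n. f n \<in> span (insert b B)" and "Cauchy f"
      have "\<forall>n. \<exists>c. f n - c *\<^sub>R b \<in> span B"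
        using f by (simp add: span_breakdown_eq)
      then obtain c where c: "\<And>n. f n - c n *\<^sub>R b \<in> span B"
        by metis
      have dist_c: "dist (c m) (c n) \<le> K * dist (f m) (f n)" for m n
      proof -
        have "(f m - c m *\<^sub>R b) - (f n - c n *\<^sub>R b) \<in> span B"
          using c span_diff by blast
        from K[OF this, of "c m - c n"] show ?thesis
          by (simp add: dist_norm algebra_simps)
      qed
      have "Cauchy c"
      proof (rule metric_CauchyI)
        fix e :: real
        assume "e > 0"
        then obtain M where M: "\<And>m n. m \<ge> M \<Longrightarrow> n \<ge> M \<Longrightarrow> dist (f m) (f n) < e / (\<bar>K\<bar> + 1)"
          using \<open>Cauchy f\<close> unfolding Cauchy_def by (metis abs_ge_zero add_nonneg_pos zero_less_divide_iff zero_less_one)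
        show "\<exists>M. \<forall>m\<ge>M. \<forall>n\<ge>M. dist (c m) (c n) < e"
        proof (intro exI allI impI)
          fix m n assume "M \<le> m" "M \<le> n"
          then have "dist (f m) (f n) * (\<bar>K\<bar> + 1) < e"
            using M[of m n] by (simp add: pos_less_divide_eq)
          moreover have "K * dist (f m) (f n) \<le> dist (f m) (f n) * (\<bar>K\<bar> + 1)"
            using mult_right_mono[of K "\<bar>K\<bar> + 1" "dist (f m) (f n)"] by (simp add: mult.commute)
          ultimately show "dist (c m) (c n) < e"
            using dist_c[of m n] by linarith
        qed
      qed
      then obtain l where l: "c \<longlonglongrightarrow> l"
        using Cauchy_convergent convergent_def by blast
      have "Cauchy (\<lambda>n. c n *\<^sub>R b)"
        using l tendsto_scaleR[OF l tendsto_const] LIMSEQ_imp_Cauchy by blast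
      then have "Cauchy (\<lambda>n. f n - c n *\<^sub>R b)"
        unfolding Cauchy_iff
      proof safe
        fix e :: real
        assume "e > 0" and cb: "\<forall>e>0. \<exists>M. \<forall>m\<ge>M. \<forall>n\<ge>M. norm (c m *\<^sub>R b - c n *\<^sub>R b) < e"
        obtain M1 where M1: "\<forall>m\<ge>M1. \<forall>n\<ge>M1. norm (c m *\<^sub>R b - c n *\<^sub>R b) < e / 2"
          using cb \<open>e > 0\<close> half_gt_zero by blast
        obtain M2 where M2: "\<forall>m\<ge>M2. \<forall>n\<ge>M2. norm (f m - f n) < e / 2"
          using \<open>Cauchy f\<close> \<open>e > 0\<close> half_gt_zero unfolding Cauchy_iff by blast
        show "\<exists>M. \<forall>m\<ge>M. \<forall>n\<ge>M. norm (f m - c m *\<^sub>R b - (f n - c n *\<^sub>R b)) < e"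
        proof (intro exI allI impI)
          fix m n assume mn: "max M1 M2 \<le> m" "max M1 M2 \<le> n"
          have "norm ((f m - f n) - (c m *\<^sub>R b - c n *\<^sub>R b)) < e"
            using norm_triangle_ineq4[of "f m - f n" "c m *\<^sub>R b - c n *\<^sub>R b"] M1[rule_format, of m n]
              M2[rule_format, of m n] mn by auto
          then show "norm (f m - c m *\<^sub>R b - (f n - c n *\<^sub>R b)) < e"
            by (simp add: algebra_simps)
        qed
      qed
      then obtain s where s: "s \<in> span B" "(\<lambda>n. f n - c n *\<^sub>R b) \<longlonglongrightarrow> s"
        using insert.IH c unfolding complete_def by meson
      have "(\<lambda>n. (f n - c n *\<^sub>R b) + c n *\<^sub>R b) \<longlonglongrightarrow> s + l *\<^sub>R b"
        by (intro tendsto_intros s l)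
      moreover have "s + l *\<^sub>R b \<in> span (insert b B)"
        using s(1) by (auto simp: span_breakdown_eq intro!: exI[of _ l])
      ultimately show "\<exists>l\<in>span (insert b B). f \<longlonglongrightarrow> l"
        by auto
    qed
  qed
qed

lemma linear_bounded_on_finite_span:
  fixes f :: "'v::real_normed_vector \<Rightarrow> 'w::real_normed_vector"
  assumes "linear f" "finite B"
  shows "\<exists>K. \<forall>x\<in>span B. norm (f x) \<le> K * norm x"
  using assms(2)
proof induction
  case empty
  then show ?case
    using assms(1) by (auto simp: linear_0)
next
  case (insert b B)
  show ?case
  proof (cases "b \<in> span B")
    case True
    then show ?thesis
      using insert by (simp add: span_redundant)
  next
    case False
    obtain K where K: "\<And>c s. s \<in> span B \<Longrightarrow> \<bar>c\<bar> \<le> K * norm (c *\<^sub>R b + s)"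
      using coefficient_bounded[OF complete_imp_closed[OF complete_finite_span] subspace_span False]
        insert by blast
    obtain L where L: "\<And>x. x \<in> span B \<Longrightarrow> norm (f x) \<le> L * norm x"
      using insert by blast
    \<comment> \<open>The constant comes from splitting \<open>x = c b + s\<close> with \<open>\<bar>c\<bar> \<le> K \<parallel>x\<parallel>\<close> and \<open>s \<in> span B\<close>.\<close>
    have "norm (f x) \<le> (K * norm (f b) + \<bar>L\<bar> * (1 + K * norm b)) * norm x"
      if x: "x \<in> span (insert b B)" for x
    proof -
      obtain c where c: "x - c *\<^sub>R b \<in> span B"
        using x by (auto simp: span_breakdown_eq)
      have cx: "\<bar>c\<bar> \<le> K * norm x"
        using K[OF c, of c] by simp
      have "norm (f x) = norm (c *\<^sub>R f b + f (x - c *\<^sub>R b))"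
        using assms(1) by (simp add: linear_diff linear_scale)
      also have "\<dots> \<le> \<bar>c\<bar> * norm (f b) + L * norm (x - c *\<^sub>R b)"
        using norm_triangle_ineq[of "c *\<^sub>R f b" "f (x - c *\<^sub>R b)"] L[OF c] by simp
      also have "\<dots> \<le> \<bar>c\<bar> * norm (f b) + \<bar>L\<bar> * (norm x + \<bar>c\<bar> * norm b)"
        using norm_triangle_ineq4[of x "c *\<^sub>R b"]
        by (intro add_left_mono mult_mono) auto
      also have "\<dots> \<le> (K * norm x) * norm (f b) + \<bar>L\<bar> * (norm x + (K * norm x) * norm b)"
        using cx by (intro add_mono mult_left_mono mult_right_mono) auto
      finally show ?thesis
        by (simp add: algebra_simps)
    qed
    then show ?thesis by blast
  qed
qed

lemma linear_imp_bounded_linear: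
  fixes f :: "'v::real_normed_vector \<Rightarrow> 'w::real_normed_vector"
  assumes "linear f" "finite_dimensional TYPE('v)"
  shows "bounded_linear f"
proof -
  obtain B :: "'v set" where "finite B" "span B = UNIV"
    using assms(2) by (auto simp: finite_dimensional_def)
  then obtain K where "\<And>x. norm (f x) \<le> K * norm x"
    using linear_bounded_on_finite_span[OF assms(1), of B] by auto
  then show ?thesis
    using assms(1) by (intro bounded_linear_intro[of f K])
      (auto simp: linear_add linear_scale mult.commute)
qed

text \<open>A basis with its coordinate functionals, bounded so that they may be composed with smooth
  functions.\<close>

lemma finite_dimensional_coordinates:
  assumes "finite_dimensional TYPE('v::real_normed_vector)"
  obtains B :: "'v::real_normed_vector set" and r :: "'v \<Rightarrow> 'v \<Rightarrow> real"
  where "finite B" "\<And>b. bounded_linear (r b)" "\<And>w. (\<Sum>b\<in>B. r b w *\<^sub>R b) = w"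
proof -
  obtain B0 :: "'v set" where B0: "finite B0" "span B0 = UNIV"
    using assms unfolding finite_dimensional_def by blast
  obtain B :: "'v set" where B: "independent B" "UNIV \<subseteq> span B"
    by (rule maximal_independent_subset[of UNIV])
  have "finite B"
    using independent_span_bound[of B0 B] B0 B(1) by blast
  define r where "r = (\<lambda>b w. representation B w b)"
  have span: "span B = UNIV"
    using B by auto
  have "linear (r b)" for b
    using B span by (intro linearI) (auto simp: r_def representation_add representation_scale)
  then have "bounded_linear (r b)" for b
    using assms by (rule linear_imp_bounded_linear)
  moreover have "(\<Sum>b\<in>B. r b w *\<^sub>R b) = w" for w
    unfolding r_def using B \<open>finite B\<close> span by (intro sum_representation_eq) auto
  ultimately show ?thesis
    using that \<open>finite B\<close> by blast
qed

lemma finite_dimensional_real: "finite_dimensional TYPE(real)"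
  unfolding finite_dimensional_def
  by (rule exI[of _ "{1}"]) (auto simp: span_singleton image_def)

lemma finite_dimensional_prod:
  assumes "finite_dimensional TYPE('a::real_normed_vector)"
    and "finite_dimensional TYPE('b::real_normed_vector)"
  shows "finite_dimensional TYPE('a::real_normed_vector \<times> 'b::real_normed_vector)"
proof -
  obtain A :: "'a set" where A: "finite A" "span A = UNIV"
    using assms by (auto simp: finite_dimensional_def)
  obtain B :: "'b set" where B: "finite B" "span B = UNIV"
    using assms by (auto simp: finite_dimensional_def)
  let ?C = "(\<lambda>a. (a, 0)) ` A \<union> (\<lambda>b. (0, b)) ` B"
  have lin: "linear (\<lambda>a::'a. (a, 0::'b))" "linear (\<lambda>b::'b. (0::'a, b))"
    by (auto intro!: linearI)
  have "(a, 0) \<in> span ?C" for a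
    using linear_span_image[OF lin(1), of A] A span_mono[of "(\<lambda>a. (a, 0)) ` A" ?C] by auto
  moreover have "(0, b) \<in> span ?C" for b
    using linear_span_image[OF lin(2), of B] B span_mono[of "(\<lambda>b. (0, b)) ` B" ?C] by auto
  ultimately have "(a, 0) + (0, b) \<in> span ?C" for a b
    by (intro span_add)
  then have "span ?C = UNIV"
    by auto
  then show ?thesis
    unfolding finite_dimensional_def using A B by (intro exI[of _ ?C]) simp
qed

section \<open>Calculus of smooth functions\<close>

lemma higher_differentiable_on_cong:
  assumes "open S" "\<And>x. x \<in> S \<Longrightarrow> f x = g x" "higher_differentiable_on S f n"
  shows "higher_differentiable_on S g n"
  using assms(2,3)
proof (induction n arbitrary: f g)
  case 0
  then show ?case
    using continuous_on_cong[of S S f g] by simp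
next
  case (Suc n)
  have diff: "g differentiable (at x)" if "x \<in> S" for x
  proof -
    obtain D where "(f has_derivative D) (at x)"
      using Suc.prems(2) \<open>x \<in> S\<close> by (auto simp: differentiable_def)
    then have "(g has_derivative D) (at x)"
      using Suc.prems(1) by (rule has_derivative_transform_within_open[OF _ assms(1) \<open>x \<in> S\<close>])
    then show ?thesis
      by (auto simp: differentiable_def)
  qed
  have "frechet_derivative f (at x) = frechet_derivative g (at x)" if "x \<in> S" for x
    using Suc.prems that assms(1) by (intro frechet_derivative_transform_within_open) auto
  then have "higher_differentiable_on S (\<lambda>x. frechet_derivative g (at x) v) n" for v
    using Suc.prems(2)
    by (intro Suc.IH[where f = "\<lambda>x. frechet_derivative f (at x) v"
          and g = "\<lambda>x. frechet_derivative g (at x) v"]) simp_all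
  with diff show ?case by simp
qed

text \<open>This allows the induction on the order to use any family of derivatives instead of the Hilbert
  choice \<open>frechet_derivative\<close>.\<close>

lemma higher_differentiable_on_SucI:
  assumes "open S" "\<And>x. x \<in> S \<Longrightarrow> (f has_derivative D x) (at x)"
    and "\<And>v. higher_differentiable_on S (\<lambda>x. D x v) n"
  shows "higher_differentiable_on S f (Suc n)"
proof -
  have "D x = frechet_derivative f (at x)" if "x \<in> S" for x
    using assms(2) that by (simp add: frechet_derivative_at)
  then have "higher_differentiable_on S (\<lambda>x. frechet_derivative f (at x) v) n" for v
    using assms by (intro higher_differentiable_on_cong[OF assms(1) _ assms(3)[of v]]) auto
  with assms show ?thesis
    by (auto simp: differentiable_def)
qed

lemma higher_differentiable_on_SucE:
  assumes "higher_differentiable_on S f (Suc n)"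
  obtains D where "\<And>x. x \<in> S \<Longrightarrow> (f has_derivative D x) (at x)"
    "\<And>v. higher_differentiable_on S (\<lambda>x. D x v) n"
  by (rule that[of "\<lambda>x. frechet_derivative f (at x)"])
    (use assms in \<open>simp_all add: frechet_derivative_works[symmetric]\<close>)

lemma higher_differentiable_on_Suc_imp:
  assumes "higher_differentiable_on S f (Suc n)"
  shows "higher_differentiable_on S f n"
  using assms
proof (induction n arbitrary: f)
  case 0
  then show ?case
    by (auto intro!: differentiable_imp_continuous_on differentiable_at_imp_differentiable_on)
next
  case (Suc n)
  then show ?case by auto
qed

lemma higher_differentiable_on_subset:
  assumes "higher_differentiable_on S f n" "T \<subseteq> S"
  shows "higher_differentiable_on T f n"
  using assms by (induction n arbitrary: f) (auto intro: continuous_on_subset)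

lemma higher_differentiable_on_local:
  assumes "\<And>x. x \<in> S \<Longrightarrow> \<exists>T. open T \<and> x \<in> T \<and> higher_differentiable_on T f n"
  shows "higher_differentiable_on S f n"
  using assms
proof (induction n arbitrary: f)
  case 0
  have "continuous (at x within S) f" if x: "x \<in> S" for x
  proof -
    obtain T where "open T" "x \<in> T" "continuous_on T f"
      using 0[OF x] by auto
    then show ?thesis
      using continuous_on_eq_continuous_at continuous_at_imp_continuous_at_within by blast
  qed
  then show ?case
    by (simp add: continuous_on_eq_continuous_within)
next
  case (Suc n)
  have "f differentiable (at x)" if "x \<in> S" for x
    using Suc.prems[OF that] by auto
  moreover have "higher_differentiable_on S (\<lambda>x. frechet_derivative f (at x) v) n" for v
    using Suc.prems by (intro Suc.IH) fastforce
  ultimately show ?case by simp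
qed

lemma higher_differentiable_on_const: "higher_differentiable_on S (\<lambda>x. c) n"
  by (induction n arbitrary: c) (auto intro: continuous_intros)

lemma higher_differentiable_on_bounded_linear_compose:
  assumes "bounded_linear L" "open S" "higher_differentiable_on S f n"
  shows "higher_differentiable_on S (\<lambda>x. L (f x)) n"
  using assms(3)
proof (induction n arbitrary: f)
  case 0
  then show ?case
    using bounded_linear.continuous_on[OF assms(1)] by simp
next
  case (Suc n)
  obtain D where D: "\<And>x. x \<in> S \<Longrightarrow> (f has_derivative D x) (at x)"
    "\<And>v. higher_differentiable_on S (\<lambda>x. D x v) n"
    using higher_differentiable_on_SucE[OF Suc.prems] by blast
  show ?case
    using D Suc.IH by (intro higher_differentiable_on_SucI[where D = "\<lambda>x v. L (D x v)"] assms(2)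
        bounded_linear.has_derivative[OF assms(1)]) auto
qed

lemma higher_differentiable_on_bounded_linear:
  assumes "bounded_linear L" "open S"
  shows "higher_differentiable_on S L n"
proof (cases n)
  case 0
  then show ?thesis
    using linear_continuous_on[OF assms(1)] by simp
next
  case (Suc m)
  show ?thesis
    unfolding Suc using assms
    by (intro higher_differentiable_on_SucI[where D = "\<lambda>x. L"] higher_differentiable_on_const
        bounded_linear_imp_has_derivative)
qed

lemma higher_differentiable_on_add:
  assumes "open S" "higher_differentiable_on S f n" "higher_differentiable_on S g n"
  shows "higher_differentiable_on S (\<lambda>x. f x + g x) n"
  using assms(2,3)
proof (induction n arbitrary: f g)
  case 0
  then show ?case by (simp add: continuous_on_add)
next
  case (Suc n)
  obtain D where D: "\<And>x. x \<in> S \<Longrightarrow> (f has_derivative D x) (at x)"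
    "\<And>v. higher_differentiable_on S (\<lambda>x. D x v) n"
    using higher_differentiable_on_SucE[OF Suc.prems(1)] by blast
  obtain E where E: "\<And>x. x \<in> S \<Longrightarrow> (g has_derivative E x) (at x)"
    "\<And>v. higher_differentiable_on S (\<lambda>x. E x v) n"
    using higher_differentiable_on_SucE[OF Suc.prems(2)] by blast
  show ?case
    using D E Suc.IH
    by (intro higher_differentiable_on_SucI[where D = "\<lambda>x v. D x v + E x v"] assms(1)
        has_derivative_add) auto
qed

lemma higher_differentiable_on_sum:
  assumes "open S" "finite I" "\<And>i. i \<in> I \<Longrightarrow> higher_differentiable_on S (f i) n"
  shows "higher_differentiable_on S (\<lambda>x. \<Sum>i\<in>I. f i x) n"
  using assms(2,3) by (induction I)
    (auto intro: higher_differentiable_on_const higher_differentiable_on_add assms(1))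

lemma higher_differentiable_on_scaleR:
  assumes "open S" "higher_differentiable_on S f n" "higher_differentiable_on S g n"
  shows "higher_differentiable_on S (\<lambda>x. f x *\<^sub>R g x) n"
  using assms(2,3)
proof (induction n arbitrary: f g)
  case 0
  then show ?case by (simp add: continuous_on_scaleR)
next
  case (Suc n)
  obtain D where D: "\<And>x. x \<in> S \<Longrightarrow> (f has_derivative D x) (at x)"
    "\<And>v. higher_differentiable_on S (\<lambda>x. D x v) n"
    using higher_differentiable_on_SucE[OF Suc.prems(1)] by blast
  obtain E where E: "\<And>x. x \<in> S \<Longrightarrow> (g has_derivative E x) (at x)"
    "\<And>v. higher_differentiable_on S (\<lambda>x. E x v) n"
    using higher_differentiable_on_SucE[OF Suc.prems(2)] by blast
  show ?case
    using D E Suc.IH Suc.prems[THEN higher_differentiable_on_Suc_imp]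
    by (intro higher_differentiable_on_SucI[where D = "\<lambda>x v. f x *\<^sub>R E x v + D x v *\<^sub>R g x"] assms(1)
        has_derivative_scaleR higher_differentiable_on_add) auto
qed

lemma higher_differentiable_on_Pair:
  assumes "open S" "higher_differentiable_on S f n" "higher_differentiable_on S g n"
  shows "higher_differentiable_on S (\<lambda>x. (f x, g x)) n"
proof -
  have "higher_differentiable_on S (\<lambda>x. (f x, 0) + (0, g x)) n"
    using assms by (intro higher_differentiable_on_add
        higher_differentiable_on_bounded_linear_compose[of "\<lambda>y. (y, 0)"]
        higher_differentiable_on_bounded_linear_compose[of "\<lambda>y. (0, y)"]
        bounded_linear_Pair bounded_linear_ident bounded_linear_zero)
  then show ?thesis by simp
qed

text \<open>With \<open>D\<close> and \<open>E\<close> the derivatives of \<open>f\<close> and \<open>g\<close>, the derivative of the composition is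
  \<open>E (f x) (D x v)\<close>, in which the direction varies with \<open>x\<close>,
  whereas the induction hypothesis covers \<open>E (f x) b\<close> only for fixed \<open>b\<close>. Expanding \<open>D x v\<close> in
  coordinates writes it as a finite sum of smooth scalars times such terms.\<close>

lemma higher_differentiable_on_compose:
  fixes f :: "'a::real_normed_vector \<Rightarrow> 'b::real_normed_vector"
    and g :: "'b \<Rightarrow> 'c::real_normed_vector"
  assumes fin: "finite_dimensional TYPE('b)" and S: "open S" and fS: "f ` S \<subseteq> T"
    and "higher_differentiable_on T g n" "higher_differentiable_on S f n"
  shows "higher_differentiable_on S (\<lambda>x. g (f x)) n"
  using assms(4,5)
proof (induction n arbitrary: g)
  case 0
  then show ?case
    using fS by (auto intro: continuous_on_compose2)
next
  case (Suc n)
  obtain D where D: "\<And>x. x \<in> S \<Longrightarrow> (f has_derivative D x) (at x)"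
    "\<And>v. higher_differentiable_on S (\<lambda>x. D x v) n"
    using higher_differentiable_on_SucE[OF Suc.prems(2)] by blast
  obtain E where E: "\<And>y. y \<in> T \<Longrightarrow> (g has_derivative E y) (at y)"
    "\<And>v. higher_differentiable_on T (\<lambda>y. E y v) n"
    using higher_differentiable_on_SucE[OF Suc.prems(1)] by blast
  obtain B :: "'b set" and r where B: "finite B" "\<And>b. bounded_linear (r b)"
    "\<And>w. (\<Sum>b\<in>B. r b w *\<^sub>R b) = w"
    using finite_dimensional_coordinates[OF fin] by blast
  have deriv: "((\<lambda>x. g (f x)) has_derivative (\<lambda>v. \<Sum>b\<in>B. r b (D x v) *\<^sub>R E (f x) b)) (at x)"
    if x: "x \<in> S" for x
  proof -
    have E': "(g has_derivative E (f x)) (at (f x))"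
      using x fS by (intro E) auto
    have "E (f x) w = (\<Sum>b\<in>B. r b w *\<^sub>R E (f x) b)" for w
    proof -
      have "linear (E (f x))"
        using E' by (simp add: bounded_linear.linear has_derivative_bounded_linear)
      then show ?thesis
        using B(3)[of w] linear_sum[of "E (f x)" "\<lambda>b. r b w *\<^sub>R b" B] by (simp add: linear_scale)
    qed
    then have "(\<lambda>v. E (f x) (D x v)) = (\<lambda>v. \<Sum>b\<in>B. r b (D x v) *\<^sub>R E (f x) b)"
      by blast
    with has_derivative_compose[OF D(1)[OF x] E'] show ?thesis
      by simp
  qed
  have "higher_differentiable_on S (\<lambda>x. E (f x) b) n" for b
    by (rule Suc.IH[OF E(2) higher_differentiable_on_Suc_imp[OF Suc.prems(2)]])
  then have "higher_differentiable_on S (\<lambda>x. \<Sum>b\<in>B. r b (D x v) *\<^sub>R E (f x) b) n" for v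
    by (intro higher_differentiable_on_sum S B(1) higher_differentiable_on_scaleR
        higher_differentiable_on_bounded_linear_compose[OF B(2) S D(2)])
  with S deriv show ?case
    by (rule higher_differentiable_on_SucI)
qed

section \<open>Differentiable maps and the chain rule\<close>

text \<open>The part of \<open>smooth_atlas\<close> that the chain rule relies on, for arbitrary topological spaces, so that
  it applies to \<open>vec_atlas\<close> on a normed space not known to be second countable.\<close>

definition topological_atlas ::
  "('m::topological_space, 'e::real_normed_vector) atlas \<Rightarrow> bool" where
  "topological_atlas A \<longleftrightarrow>
     \<Union>(fst ` A) = UNIV \<and>
     (\<forall>(U, \<phi>)\<in>A. open U \<and> open (\<phi> ` U) \<and> homeomorphism U (\<phi> ` U) \<phi> (inv_into U \<phi>))"

lemma smooth_atlas_imp_topological_atlas: "smooth_atlas A \<Longrightarrow> topological_atlas A"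
  by (simp add: smooth_atlas_def topological_atlas_def)

lemma topological_vec_atlas: "topological_atlas vec_atlas"
  by (simp add: topological_atlas_def vec_atlas_def homeomorphism_def inv_into_def)

lemma chartD:
  assumes "topological_atlas A" "(U, \<phi>) \<in> A"
  shows "open U" "open (\<phi> ` U)" "inj_on \<phi> U" "continuous_on U \<phi>"
    "continuous_on (\<phi> ` U) (inv_into U \<phi>)"
proof -
  have "homeomorphism U (\<phi> ` U) \<phi> (inv_into U \<phi>)"
    using assms by (auto simp: topological_atlas_def)
  then show "inj_on \<phi> U" "continuous_on U \<phi>" "continuous_on (\<phi> ` U) (inv_into U \<phi>)"
    by (auto simp: homeomorphism_def intro: inj_on_inverseI)
  show "open U" "open (\<phi> ` U)"
    using assms by (auto simp: topological_atlas_def)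
qed

lemma chart_at_in_atlas:
  assumes "topological_atlas A"
  shows "(fst (chart_at A x), coord A x) \<in> A" "x \<in> fst (chart_at A x)"
proof -
  have "x \<in> \<Union>(fst ` A)"
    using assms by (simp add: topological_atlas_def)
  then have "\<exists>c. c \<in> A \<and> x \<in> fst c"
    by blast
  then have "chart_at A x \<in> A \<and> x \<in> fst (chart_at A x)"
    unfolding chart_at_def by (rule someI_ex)
  then show "(fst (chart_at A x), coord A x) \<in> A" "x \<in> fst (chart_at A x)"
    by (simp_all add: coord_def)
qed

lemma coord_inv_coord:
  assumes "topological_atlas A" "y \<in> fst (chart_at A x)"
  shows "coord_inv A x (coord A x y) = y"
  using chartD(3)[OF assms(1) chart_at_in_atlas(1)[OF assms(1), of x]] assms(2)
  by (simp add: coord_inv_def)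

lemma coord_coord_inv: "z \<in> coord A x ` fst (chart_at A x) \<Longrightarrow> coord A x (coord_inv A x z) = z"
  by (simp add: coord_inv_def f_inv_into_f)

lemma coord_inv_base:
  assumes "topological_atlas A"
  shows "coord_inv A x (coord A x x) = x"
  by (simp add: assms coord_inv_coord chart_at_in_atlas(2))

lemma isCont_coord_inv:
  assumes "topological_atlas A"
  shows "isCont (coord_inv A x) (coord A x x)"
proof -
  note c = chartD[OF assms chart_at_in_atlas(1)[OF assms, of x]]
  have "coord A x x \<in> coord A x ` fst (chart_at A x)"
    using chart_at_in_atlas(2)[OF assms] by blast
  then show ?thesis
    using continuous_on_interior[OF c(5)] interior_open[OF c(2)] by (simp add: coord_inv_def)
qed

lemma chart_at_vec_atlas [simp]: "chart_at vec_atlas x = (UNIV, id)"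
  unfolding chart_at_def vec_atlas_def by (rule some_equality) auto

lemma coord_vec_atlas [simp]: "coord vec_atlas x = id"
  by (simp add: coord_def)

lemma coord_inv_vec_atlas [simp]: "coord_inv vec_atlas x = id"
  by (auto simp: coord_inv_def inv_into_def)

text \<open>Continuity is required separately: differentiability in coordinates says nothing unless \<open>f\<close> maps a
  neighbourhood of \<open>x\<close> into the chart at \<open>f x\<close>.\<close>

definition manifold_differentiable_at ::
  "('m::t2_space, 'e::real_normed_vector) atlas \<Rightarrow> ('n::topological_space, 'f::real_normed_vector) atlas \<Rightarrow>
   ('m \<Rightarrow> 'n) \<Rightarrow> 'm \<Rightarrow> bool" where
  "manifold_differentiable_at A B f x \<longleftrightarrow>
     isCont f x \<and> (coord B (f x) \<circ> f \<circ> coord_inv A x) differentiable (at (coord A x x))"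

lemma has_derivative_tangent_map:
  assumes "manifold_differentiable_at A B f x"
  shows "((coord B (f x) \<circ> f \<circ> coord_inv A x) has_derivative tangent_map A B f x) (at (coord A x x))"
proof -
  have D: "((coord B (f x) \<circ> f \<circ> coord_inv A x) has_derivative
      frechet_derivative (coord B (f x) \<circ> f \<circ> coord_inv A x) (at (coord A x x))) (at (coord A x x))"
    using assms unfolding manifold_differentiable_at_def by (simp add: frechet_derivative_works)
  then show ?thesis
    using bounded_linear_Blinfun_apply[OF has_derivative_bounded_linear[OF D]]
    by (simp add: tangent_map_def)
qed

lemma tangent_map_eqI:
  assumes "((coord B (f x) \<circ> f \<circ> coord_inv A x) has_derivative blinfun_apply T) (at (coord A x x))"
  shows "tangent_map A B f x = T"
  by (simp add: tangent_map_def frechet_derivative_at[OF assms, symmetric] blinfun_apply_inverse)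

text \<open>In coordinates the composition agrees with the composition of the coordinate expressions near the
  base point, since by continuity \<open>f\<close> stays in the chart at \<open>f x\<close> there; the ordinary chain rule
  applies.\<close>

lemma
  assumes A: "topological_atlas A" and B: "topological_atlas B"
    and f: "manifold_differentiable_at A B f x" and g: "manifold_differentiable_at B C g (f x)"
  shows manifold_differentiable_at_compose: "manifold_differentiable_at A C (\<lambda>x. g (f x)) x" (is ?diff)
    and tangent_map_compose:
      "tangent_map A C (\<lambda>x. g (f x)) x = tangent_map B C g (f x) o\<^sub>L tangent_map A B f x" (is ?eq)
proof -
  let ?V = "fst (chart_at B (f x))"
  let ?F = "coord B (f x) \<circ> f \<circ> coord_inv A x"
  let ?K = "coord C (g (f x)) \<circ> g \<circ> coord_inv B (f x)"
  have x: "coord_inv A x (coord A x x) = x"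
    using coord_inv_base[OF A] .
  have V: "open ?V" "f x \<in> ?V"
    using chartD(1)[OF B] chart_at_in_atlas[OF B, of "f x"] by auto
  have contf: "isCont f x" and contg: "isCont g (f x)"
    using f g by (auto simp: manifold_differentiable_at_def)
  have "isCont (\<lambda>z. f (coord_inv A x z)) (coord A x x)"
    using isCont_o2[OF isCont_coord_inv[OF A]] contf x by metis
  then have "((\<lambda>z. f (coord_inv A x z)) \<longlongrightarrow> f x) (at (coord A x x))"
    using x by (simp add: isCont_def)
  then have ev: "\<forall>\<^sub>F z in at (coord A x x). f (coord_inv A x z) \<in> ?V"
    using V by (rule topological_tendstoD)
  have "?F (coord A x x) = coord B (f x) (f x)"
    using x by simp
  then have "((\<lambda>z. ?K (?F z)) has_derivative
      (\<lambda>v. tangent_map B C g (f x) (tangent_map A B f x v))) (at (coord A x x))"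
    using has_derivative_tangent_map[OF g]
    by (intro has_derivative_compose[OF has_derivative_tangent_map[OF f]]) (simp only:)
  then have deriv: "((coord C (g (f x)) \<circ> (\<lambda>x. g (f x)) \<circ> coord_inv A x) has_derivative
      blinfun_apply (tangent_map B C g (f x) o\<^sub>L tangent_map A B f x)) (at (coord A x x))"
    unfolding blinfun_apply_blinfun_compose
    by (rule has_derivative_transform_eventually)
      (use ev in \<open>auto elim!: eventually_mono simp: coord_inv_coord[OF B] x V\<close>)
  show ?eq
    using deriv by (rule tangent_map_eqI)
  show ?diff
    unfolding manifold_differentiable_at_def
    using deriv isCont_o2[OF contf contg] by (auto simp: differentiable_def)
qed

lemma smooth_map_imp_manifold_differentiable_at:
  assumes A: "topological_atlas A" and B: "topological_atlas B" and f: "smooth_map A B UNIV f"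
  shows "manifold_differentiable_at A B f x"
proof -
  let ?U = "fst (chart_at A x)" and ?V = "fst (chart_at B (f x))"
  have "smooth_on (coord A x ` (UNIV \<inter> ?U \<inter> f -` ?V)) (coord B (f x) \<circ> f \<circ> inv_into ?U (coord A x))"
    using f chart_at_in_atlas(1)[OF A, of x] chart_at_in_atlas(1)[OF B, of "f x"]
    unfolding smooth_map_def by blast
  then have "higher_differentiable_on (coord A x ` (UNIV \<inter> ?U \<inter> f -` ?V))
      (coord B (f x) \<circ> f \<circ> coord_inv A x) (Suc 0)"
    by (simp only: smooth_on_def coord_inv_def)
  moreover have "coord A x x \<in> coord A x ` (UNIV \<inter> ?U \<inter> f -` ?V)"
    using chart_at_in_atlas(2)[OF A] chart_at_in_atlas(2)[OF B] by blast
  moreover have "isCont f x"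
    using f by (simp add: smooth_map_def continuous_on_eq_continuous_at)
  ultimately show ?thesis
    unfolding manifold_differentiable_at_def higher_differentiable_on.simps by blast
qed

lemma
  assumes "bounded_linear L"
  shows manifold_differentiable_at_bounded_linear: "manifold_differentiable_at vec_atlas vec_atlas L x"
    and tangent_map_bounded_linear: "tangent_map vec_atlas vec_atlas L x = Blinfun L"
proof -
  have L: "(L has_derivative L) (at x)"
    using assms by (rule bounded_linear_imp_has_derivative)
  then show "manifold_differentiable_at vec_atlas vec_atlas L x"
    using has_derivative_continuous by (auto simp: manifold_differentiable_at_def differentiable_def)
  show "tangent_map vec_atlas vec_atlas L x = Blinfun L"
    using L by (intro tangent_map_eqI) (simp add: bounded_linear_Blinfun_apply assms)
qed

section \<open>Smooth maps of two variables\<close>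

text \<open>The product charts refer to \<open>inv_into (U \<times> V) (map_prod \<phi> \<psi>)\<close>, which on \<open>\<phi> ` U \<times> \<psi> ` V\<close>
  is computed componentwise.\<close>

lemma smooth_on_prod_chart:
  assumes A: "topological_atlas A" "(U, \<phi>) \<in> A" and B: "topological_atlas B" "(V, \<psi>) \<in> B"
    and C: "topological_atlas C" "(W, \<theta>) \<in> C"
    and F: "smooth_map (prod_atlas A B) C UNIV F"
  defines "S \<equiv> {z \<in> \<phi> ` U \<times> \<psi> ` V. F (inv_into U \<phi> (fst z), inv_into V \<psi> (snd z)) \<in> W}"
  shows "smooth_on S (\<lambda>z. \<theta> (F (inv_into U \<phi> (fst z), inv_into V \<psi> (snd z))))"
proof -
  note a = chartD[OF A] and b = chartD[OF B] and c = chartD[OF C]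
  have contF: "continuous_on UNIV F"
    using F by (simp add: smooth_map_def)
  have "continuous_on (\<phi> ` U \<times> \<psi> ` V) (\<lambda>z. inv_into U \<phi> (fst z))"
    by (rule continuous_on_compose2[OF a(5) continuous_on_fst[OF continuous_on_id]]) auto
  moreover have "continuous_on (\<phi> ` U \<times> \<psi> ` V) (\<lambda>z. inv_into V \<psi> (snd z))"
    by (rule continuous_on_compose2[OF b(5) continuous_on_snd[OF continuous_on_id]]) auto
  ultimately have "continuous_on (\<phi> ` U \<times> \<psi> ` V) (\<lambda>z. (inv_into U \<phi> (fst z), inv_into V \<psi> (snd z)))"
    by (rule continuous_on_Pair)
  then have "continuous_on (\<phi> ` U \<times> \<psi> ` V) (\<lambda>z. F (inv_into U \<phi> (fst z), inv_into V \<psi> (snd z)))"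
    by (rule continuous_on_compose2[OF contF]) simp
  from continuous_open_preimage[OF this open_Times[OF a(2) b(2)] c(1)]
  have S: "open S"
    by (simp add: S_def vimage_def Int_def)
  let ?I = "inv_into (U \<times> V) (map_prod \<phi> \<psi>)"
  have inj: "inj_on (map_prod \<phi> \<psi>) (U \<times> V)"
    using a(3) b(3) by (rule map_prod_inj_on)
  have I: "?I z = (inv_into U \<phi> (fst z), inv_into V \<psi> (snd z))" if "z \<in> \<phi> ` U \<times> \<psi> ` V" for z
    using that by (intro inv_into_f_eq[OF inj]) (auto simp: inv_into_into f_inv_into_f)
  have "S = map_prod \<phi> \<psi> ` (UNIV \<inter> (U \<times> V) \<inter> F -` W)"
  proof (intro subset_antisym subsetI)
    fix z assume z: "z \<in> S"
    then have "(inv_into U \<phi> (fst z), inv_into V \<psi> (snd z)) \<in> UNIV \<inter> (U \<times> V) \<inter> F -` W"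
      by (auto simp: S_def inv_into_into)
    moreover have "z = map_prod \<phi> \<psi> (inv_into U \<phi> (fst z), inv_into V \<psi> (snd z))"
      using z by (auto simp: S_def f_inv_into_f)
    ultimately show "z \<in> map_prod \<phi> \<psi> ` (UNIV \<inter> (U \<times> V) \<inter> F -` W)"
      by (rule rev_image_eqI)
  next
    fix z assume "z \<in> map_prod \<phi> \<psi> ` (UNIV \<inter> (U \<times> V) \<inter> F -` W)"
    then show "z \<in> S"
      using a(3) b(3) by (auto simp: S_def)
  qed
  moreover have "(U \<times> V, map_prod \<phi> \<psi>) \<in> prod_atlas A B"
    using A B by (auto simp: prod_atlas_def)
  ultimately have "smooth_on S (\<theta> \<circ> F \<circ> ?I)"
    using F C(2) unfolding smooth_map_def by blast
  then have smooth: "higher_differentiable_on S (\<theta> \<circ> F \<circ> ?I) n" for n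
    by (simp add: smooth_on_def)
  have eq: "(\<theta> \<circ> F \<circ> ?I) z = \<theta> (F (inv_into U \<phi> (fst z), inv_into V \<psi> (snd z)))"
    if "z \<in> S" for z
    using that I by (simp add: S_def)
  show "smooth_on S (\<lambda>z. \<theta> (F (inv_into U \<phi> (fst z), inv_into V \<psi> (snd z))))"
    unfolding smooth_on_def
    using higher_differentiable_on_cong[OF S eq smooth] by (rule allI)
qed

text \<open>The coordinates are those of the preferred charts at \<open>x\<close> and \<open>y\<close>, whose product need not be the
  preferred chart of \<open>prod_atlas A B\<close> at \<open>(x, y)\<close>; in this form the two factors can be varied
  separately.\<close>

lemma smooth_map_prod_differentiable:
  assumes A: "topological_atlas A" and B: "topological_atlas B" and C: "topological_atlas C"
    and F: "smooth_map (prod_atlas A B) C UNIV F"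
  shows "(\<lambda>z. coord C (F (x, y)) (F (coord_inv A x (fst z), coord_inv B y (snd z))))
    differentiable (at (coord A x x, coord B y y))"
proof -
  let ?U = "fst (chart_at A x)" and ?V = "fst (chart_at B y)" and ?W = "fst (chart_at C (F (x, y)))"
  have "(coord A x x, coord B y y) \<in> {z \<in> coord A x ` ?U \<times> coord B y ` ?V.
      F (inv_into ?U (coord A x) (fst z), inv_into ?V (coord B y) (snd z)) \<in> ?W}"
    using chart_at_in_atlas(2)[OF A] chart_at_in_atlas(2)[OF B] chart_at_in_atlas(2)[OF C]
      coord_inv_base[OF A, of x] coord_inv_base[OF B, of y]
    by (simp add: coord_inv_def)
  moreover note smooth_on_prod_chart[OF A chart_at_in_atlas(1)[OF A, of x]
      B chart_at_in_atlas(1)[OF B, of y] C chart_at_in_atlas(1)[OF C, of "F (x, y)"] F,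
      unfolded smooth_on_def, rule_format, of "Suc 0", unfolded higher_differentiable_on.simps]
  ultimately show ?thesis
    unfolding coord_inv_def by blast
qed

lemma
  assumes A: "topological_atlas A" and B: "topological_atlas B" and C: "topological_atlas C"
    and F: "smooth_map (prod_atlas A B) C UNIV F"
  shows manifold_differentiable_at_fst_variable: "manifold_differentiable_at A C (\<lambda>x. F (x, y)) x" (is ?fst)
    and manifold_differentiable_at_snd_variable: "manifold_differentiable_at B C (\<lambda>y. F (x, y)) y" (is ?snd)
proof -
  let ?K = "\<lambda>z. coord C (F (x, y)) (F (coord_inv A x (fst z), coord_inv B y (snd z)))"
  have K: "(?K has_derivative frechet_derivative ?K (at (coord A x x, coord B y y)))
      (at (coord A x x, coord B y y))"
    using smooth_map_prod_differentiable[OF assms] by (simp add: frechet_derivative_works)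
  have contF: "continuous_on UNIV F"
    using F by (simp add: smooth_map_def)
  have "((\<lambda>u. (u, coord B y y)) has_derivative (\<lambda>v. (v, 0))) (at (coord A x x))"
    "((\<lambda>u. (coord A x x, u)) has_derivative (\<lambda>v. (0, v))) (at (coord B y y))"
    by (auto intro!: derivative_eq_intros)
  from this[THEN has_derivative_compose, OF K] K
  show ?fst ?snd
    unfolding manifold_differentiable_at_def differentiable_def
    by (auto simp: o_def coord_inv_base[OF A] coord_inv_base[OF B]
        intro!: continuous_on_interior[of UNIV] continuous_on_compose2[OF contF] continuous_intros)
qed

section \<open>Translations, the adjoint action and the momentum map\<close>

context lie_group
begin

lemma topological_atlas_group: "topological_atlas (atlas G)"
  by (rule smooth_atlas_imp_topological_atlas[OF smooth_atlas])

lemma in_carrier_UNIV [simp]: "x \<in> carrier G"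
  by (simp add: carrier_UNIV)

lemma
  shows manifold_differentiable_at_left_mult: "manifold_differentiable_at (atlas G) (atlas G) (\<lambda>x. a \<otimes> x) y"
    and manifold_differentiable_at_right_mult: "manifold_differentiable_at (atlas G) (atlas G) (\<lambda>x. x \<otimes> a) y"
  using manifold_differentiable_at_snd_variable[OF topological_atlas_group topological_atlas_group
      topological_atlas_group smooth_mult, of a y]
    manifold_differentiable_at_fst_variable[OF topological_atlas_group topological_atlas_group
      topological_atlas_group smooth_mult, of a y]
  by simp_all

lemma manifold_differentiable_at_conjugation:
  "manifold_differentiable_at (atlas G) (atlas G) (\<lambda>x. a \<otimes> x \<otimes> inv a) y"
  by (rule manifold_differentiable_at_compose[OF topological_atlas_group topological_atlas_group
      manifold_differentiable_at_left_mult manifold_differentiable_at_right_mult])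

text \<open>Conjugation by a product is a composition of conjugations, and these fix the identity.\<close>

lemma Ad_mult: "Ad G (a \<otimes> b) = Ad G a o\<^sub>L Ad G b"
proof -
  have "(\<lambda>x. a \<otimes> b \<otimes> x \<otimes> inv (a \<otimes> b)) = (\<lambda>x. a \<otimes> (b \<otimes> x \<otimes> inv b) \<otimes> inv a)"
    by (simp add: m_assoc inv_mult_group)
  moreover have "b \<otimes> \<one> \<otimes> inv b = \<one>"
    by simp
  ultimately show ?thesis
    using tangent_map_compose[OF topological_atlas_group topological_atlas_group
        manifold_differentiable_at_conjugation[of b \<one>] manifold_differentiable_at_conjugation[of a]]
    unfolding Ad_def by simp
qed

text \<open>Both sides are tangent maps at the identity of the conjugation \<open>x \<mapsto> a\<inverse> x a\<close>.\<close>

lemma tangent_left_right_eq_Ad: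
  "tangent_left G (inv a) (a \<otimes> \<one>) o\<^sub>L tangent_right G a \<one> = Ad G (inv a)"
  using tangent_map_compose[OF topological_atlas_group topological_atlas_group
      manifold_differentiable_at_right_mult[of a \<one>] manifold_differentiable_at_left_mult[of "inv a"]]
  by (simp add: tangent_left_def tangent_right_def Ad_def m_assoc)

text \<open>The momentum map in the body frame: \<open>\<langle>a \<mu>, \<zeta> a\<rangle> = \<langle>\<mu>, a\<inverse> \<zeta> a\<rangle>\<close>, as left translation of
  covectors is dual to left translation of vectors by the inverse.\<close>

lemma momentum_map_left_translate:
  "momentum_map G K (a, cotangent_left G a \<one> \<mu>) = (\<lambda>\<zeta>\<in>K. \<mu> (Ad G (inv a) \<zeta>))"
  using arg_cong[OF tangent_left_right_eq_Ad[of a], of blinfun_apply]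
  by (simp add: momentum_map_def cotangent_left_def fun_eq_iff restrict_def)

lemma momentum_map_eq_inclusion_dual:
  "momentum_map G K (a, q) = inclusion_dual K (cotangent_right G (inv a) a q)"
  by (simp add: momentum_map_def inclusion_dual_def cotangent_right_def)

end

section \<open>The infinitesimal action\<close>

locale lie_group_representation = lie_group G
  for G :: "('g::{t2_space,second_countable_topology}, 'e::real_normed_vector) lie_data" (structure) +
  fixes \<rho> :: "'g \<Rightarrow> 'v::real_normed_vector \<Rightarrow> 'v"
  assumes representation: "lie_representation G \<rho>"
begin

lemma bounded_linear_action: "bounded_linear (\<rho> a)"
  using representation by (simp add: lie_representation_def linear_imp_bounded_linear)

lemma action_mult: "\<rho> (a \<otimes> b) v = \<rho> a (\<rho> b v)"
proof -
  interpret group_action G UNIV \<rho>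
    using representation by (simp add: lie_representation_def)
  show ?thesis
    by (simp add: composition_rule)
qed

lemma action_one [simp]: "\<rho> \<one> v = v"
proof -
  interpret group_action G UNIV \<rho>
    using representation by (simp add: lie_representation_def)
  show ?thesis
    by (simp flip: id_eq_one)
qed

lemma dual_action_apply: "dual_action G \<rho> a \<alpha> v = \<alpha> (\<rho> (inv a) v)"
  by (simp add: dual_action_def bounded_linear_Blinfun_apply bounded_linear_action)

lemma manifold_differentiable_at_orbit_map:
  "manifold_differentiable_at (atlas G) vec_atlas (\<lambda>x. \<rho> x v) a"
  using manifold_differentiable_at_fst_variable[OF topological_atlas_group topological_vec_atlas
      topological_vec_atlas, of "\<lambda>(g, v). \<rho> g v"] representation
  by (simp add: lie_representation_def)

text \<open>Differentiate \<open>(a\<inverse> x a) v = a\<inverse> (x (a v))\<close> with respect to \<open>x\<close> at the identity.\<close>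

lemma infinitesimal_action_Ad:
  "infinitesimal_action G \<rho> v (Ad G (inv a) \<zeta>) = \<rho> (inv a) (infinitesimal_action G \<rho> (\<rho> a v) \<zeta>)"
proof -
  have one: "inv a \<otimes> \<one> \<otimes> inv (inv a) = \<one>"
    by simp
  have "infinitesimal_action G \<rho> v o\<^sub>L Ad G (inv a)
      = tangent_map (atlas G) vec_atlas (\<lambda>x. \<rho> (inv a \<otimes> x \<otimes> inv (inv a)) v) \<one>"
    unfolding infinitesimal_action_def Ad_def
    using tangent_map_compose[OF topological_atlas_group topological_atlas_group
        manifold_differentiable_at_conjugation[of "inv a" \<one>] manifold_differentiable_at_orbit_map[of v]]
    unfolding one by simp
  also have "\<dots> = tangent_map (atlas G) vec_atlas (\<lambda>x. \<rho> (inv a) (\<rho> x (\<rho> a v))) \<one>"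
    by (simp add: action_mult m_assoc)
  also have "\<dots> = Blinfun (\<rho> (inv a)) o\<^sub>L infinitesimal_action G \<rho> (\<rho> a v)"
    using tangent_map_compose[OF topological_atlas_group topological_vec_atlas
        manifold_differentiable_at_orbit_map[of "\<rho> a v" \<one>]
        manifold_differentiable_at_bounded_linear[OF bounded_linear_action[of "inv a"]]]
    by (simp add: infinitesimal_action_def tangent_map_bounded_linear bounded_linear_action)
  finally show ?thesis
    by (metis blinfun_apply_blinfun_compose bounded_linear_Blinfun_apply bounded_linear_action)
qed

text \<open>Equivariance moves the force term of a step, which is taken at the translated parameter
  \<open>a\<inverse>\<cdot>\<alpha>\<close>, back to the reference parameter \<open>\<alpha>\<close>, whose isotropy is at hand.\<close>

lemma diamond_dual_action_Ad:
  "diamond G \<rho> v (dual_action G \<rho> (inv a) \<alpha>) (Ad G (inv a) \<zeta>)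
     = \<alpha> (infinitesimal_action G \<rho> (\<rho> a v) \<zeta>)"
proof -
  have "\<rho> (inv (inv a)) (\<rho> (inv a) w) = w" for w
    by (simp flip: action_mult)
  then show ?thesis
    by (simp only: diamond_def blinfun_apply_blinfun_compose dual_action_apply infinitesimal_action_Ad)
qed

lemma stabilizer_fixes_pairing:
  assumes "x \<in> stabilizer G (dual_action G \<rho>) \<alpha>"
  shows "blinfun_apply \<alpha> (\<rho> x v) = \<alpha> v"
proof -
  have "dual_action G \<rho> x \<alpha> (\<rho> x v) = \<alpha> (\<rho> x v)"
    using assms by (simp add: stabilizer_def)
  then show ?thesis
    by (simp add: dual_action_apply flip: action_mult)
qed

text \<open>Along a curve \<open>c\<close> in the isotropy group the function \<open>t \<mapsto> \<langle>c(t) v, \<alpha>\<rangle>\<close> is constant, and its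
  derivative at \<open>0\<close> is the asserted quantity.\<close>

lemma infinitesimal_action_annihilated:
  assumes "\<zeta> \<in> lie_subalgebra G (stabilizer G (dual_action G \<rho>) \<alpha>)"
  shows "blinfun_apply \<alpha> (infinitesimal_action G \<rho> v \<zeta>) = 0"
proof -
  obtain c :: "real \<Rightarrow> 'g" where \<zeta>: "\<zeta> = tangent_map vec_atlas (atlas G) c 0 1"
    and c: "smooth_map vec_atlas (atlas G) UNIV c" "c 0 = \<one>"
      "range c \<subseteq> stabilizer G (dual_action G \<rho>) \<alpha>"
    using assms unfolding lie_subalgebra_def by blast
  have dc: "manifold_differentiable_at vec_atlas (atlas G) c 0"
    by (rule smooth_map_imp_manifold_differentiable_at[OF topological_vec_atlas topological_atlas_group c(1)])
  have d\<rho>: "manifold_differentiable_at (atlas G) vec_atlas (\<lambda>x. \<rho> x v) (c 0)"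
    by (rule manifold_differentiable_at_orbit_map)
  note dcurve = manifold_differentiable_at_compose[OF topological_vec_atlas topological_atlas_group dc d\<rho>]
  note tcurve = tangent_map_compose[OF topological_vec_atlas topological_atlas_group dc d\<rho>]
  have "((\<lambda>t. \<alpha> (\<rho> (c t) v)) has_derivative
      (\<lambda>t. \<alpha> (tangent_map vec_atlas vec_atlas (\<lambda>t. \<rho> (c t) v) 0 t))) (at 0)"
    using bounded_linear.has_derivative[OF blinfun.bounded_linear_right has_derivative_tangent_map[OF dcurve]]
    by (simp add: o_def)
  moreover have "(\<lambda>t. \<alpha> (\<rho> (c t) v)) = (\<lambda>t. \<alpha> v)"
    using c(3) by (intro ext stabilizer_fixes_pairing) auto
  ultimately have "(\<lambda>t. \<alpha> (tangent_map vec_atlas vec_atlas (\<lambda>t. \<rho> (c t) v) 0 t)) = (\<lambda>t. 0)"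
    by (metis has_derivative_const has_derivative_unique)
  then have "\<alpha> (tangent_map vec_atlas vec_atlas (\<lambda>t. \<rho> (c t) v) 0 1) = 0"
    by metis
  then show ?thesis
    using tcurve c(2) by (simp add: infinitesimal_action_def \<zeta>)
qed

lemma stabilizer_mult_closed:
  assumes "x \<in> stabilizer G (dual_action G \<rho>) \<alpha>" "y \<in> stabilizer G (dual_action G \<rho>) \<alpha>"
  shows "x \<otimes> y \<in> stabilizer G (dual_action G \<rho>) \<alpha>"
proof -
  have "dual_action G \<rho> (x \<otimes> y) \<alpha> = dual_action G \<rho> x (dual_action G \<rho> y \<alpha>)"
    by (rule blinfun_eqI) (simp add: dual_action_apply inv_mult_group action_mult)
  then show ?thesis
    using assms by (simp add: stabilizer_def)
qed

end

section \<open>The Lie algebra of a subgroup is a subspace\<close>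

lemma smooth_map_vec_atlas_iff:
  "smooth_map vec_atlas B UNIV f \<longleftrightarrow>
    continuous_on UNIV f \<and> (\<forall>(V, \<psi>)\<in>B. smooth_on (f -` V) (\<lambda>x. \<psi> (f x)))"
proof -
  have "inv_into UNIV id = id"
    by (auto simp: inv_into_def)
  then show ?thesis
    by (simp add: smooth_map_def vec_atlas_def o_def)
qed

context lie_group
begin

text \<open>Rescaling the parameter of a curve by \<open>r\<close> multiplies its velocity by \<open>r\<close>.\<close>

lemma lie_subalgebra_scale:
  assumes "\<zeta> \<in> lie_subalgebra G K"
  shows "r *\<^sub>R \<zeta> \<in> lie_subalgebra G K"
proof -
  obtain c :: "real \<Rightarrow> 'g" where \<zeta>: "\<zeta> = tangent_map vec_atlas (atlas G) c 0 1"
    and c: "smooth_map vec_atlas (atlas G) UNIV c" "c 0 = \<one>" "range c \<subseteq> K"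
    using assms unfolding lie_subalgebra_def by blast
  have r: "bounded_linear (\<lambda>t::real. r * t)"
    by (rule bounded_linear_mult_right)
  have contc: "continuous_on UNIV c"
    using c(1) by (simp add: smooth_map_def)
  have contrc: "continuous_on UNIV (\<lambda>t. c (r * t))"
    by (rule continuous_on_compose2[OF contc]) (auto intro: continuous_intros)
  have "smooth_on ((\<lambda>t. c (r * t)) -` V) (\<lambda>t. \<psi> (c (r * t)))" if "(V, \<psi>) \<in> atlas G" for V \<psi>
    unfolding smooth_on_def
  proof
    fix n
    have V: "open V"
      using chartD(1)[OF topological_atlas_group that] .
    have \<psi>c: "higher_differentiable_on (c -` V) (\<lambda>t. \<psi> (c t)) n"
      using c(1) that unfolding smooth_map_vec_atlas_iff smooth_on_def
      by blast
    have op: "open ((\<lambda>t. c (r * t)) -` V)"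
      using contrc V by (rule open_vimage[rotated])
    show "higher_differentiable_on ((\<lambda>t. c (r * t)) -` V) (\<lambda>t. \<psi> (c (r * t))) n"
      by (rule higher_differentiable_on_compose[OF finite_dimensional_real op _ \<psi>c
            higher_differentiable_on_bounded_linear[OF r op]]) auto
  qed
  then have "smooth_map vec_atlas (atlas G) UNIV (\<lambda>t. c (r * t))"
    using contrc by (auto simp: smooth_map_vec_atlas_iff)
  moreover have "r *\<^sub>R \<zeta> = tangent_map vec_atlas (atlas G) (\<lambda>t. c (r * t)) 0 1"
  proof -
    have dc: "manifold_differentiable_at vec_atlas (atlas G) c (r * 0)"
      by (rule smooth_map_imp_manifold_differentiable_at[OF topological_vec_atlas topological_atlas_group c(1)])
    show ?thesis
      using tangent_map_compose[OF topological_vec_atlas topological_vec_atlas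
          manifold_differentiable_at_bounded_linear[OF r] dc]
        blinfun.scaleR_right[of "tangent_map vec_atlas (atlas G) c 0" r 1]
      by (simp add: \<zeta> tangent_map_bounded_linear[OF r] bounded_linear_Blinfun_apply[OF r])
  qed
  ultimately show ?thesis
    unfolding lie_subalgebra_def using c(2,3) by (auto intro!: exI[of _ "\<lambda>t. c (r * t)"])
qed

text \<open>Smoothness is a local matter: near \<open>t0\<close> both curves stay in the charts at their values at \<open>t0\<close>, and
  the product is the multiplication in these charts composed with the pair of coordinate curves.\<close>

lemma smooth_map_mult_curves:
  fixes c1 c2 :: "real \<Rightarrow> 'g"
  assumes c1: "smooth_map vec_atlas (atlas G) UNIV c1"
    and c2: "smooth_map vec_atlas (atlas G) UNIV c2"
  shows "smooth_map vec_atlas (atlas G) UNIV (\<lambda>t. c1 t \<otimes> c2 t)"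
proof -
  note top = topological_atlas_group
  have cont1: "continuous_on UNIV c1" and cont2: "continuous_on UNIV c2"
    using c1 c2 by (simp_all add: smooth_map_def)
  have contm: "continuous_on UNIV (\<lambda>(x, y). x \<otimes> y)"
    using smooth_mult by (simp add: smooth_map_def)
  have cont: "continuous_on UNIV (\<lambda>t. c1 t \<otimes> c2 t)"
    using continuous_on_compose2[OF contm continuous_on_Pair[OF cont1 cont2]] by simp
  have fin: "finite_dimensional TYPE('e \<times> 'e)"
    using smooth_atlas by (intro finite_dimensional_prod) (simp_all add: smooth_atlas_def)
  have "smooth_on ((\<lambda>t. c1 t \<otimes> c2 t) -` W) (\<lambda>t. \<theta> (c1 t \<otimes> c2 t))" if W: "(W, \<theta>) \<in> atlas G" for W \<theta>
    unfolding smooth_on_def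
  proof (intro allI higher_differentiable_on_local)
    fix n t0
    assume t0: "t0 \<in> (\<lambda>t. c1 t \<otimes> c2 t) -` W"
    let ?U = "fst (chart_at (atlas G) (c1 t0))" and ?\<phi> = "coord (atlas G) (c1 t0)"
    let ?V = "fst (chart_at (atlas G) (c2 t0))" and ?\<psi> = "coord (atlas G) (c2 t0)"
    note U = chart_at_in_atlas[OF top, of "c1 t0"] and V = chart_at_in_atlas[OF top, of "c2 t0"]
    define T where "T = c1 -` ?U \<inter> c2 -` ?V \<inter> (\<lambda>t. c1 t \<otimes> c2 t) -` W"
    have T: "open T" "t0 \<in> T"
      unfolding T_def
      using chartD(1)[OF top U(1)] chartD(1)[OF top V(1)] chartD(1)[OF top W]
        cont cont1 cont2 U(2) V(2) t0
      by (auto intro!: open_Int open_vimage)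
    have "higher_differentiable_on (c1 -` ?U) (\<lambda>t. ?\<phi> (c1 t)) n"
      "higher_differentiable_on (c2 -` ?V) (\<lambda>t. ?\<psi> (c2 t)) n"
      using c1 c2 U(1) V(1) unfolding smooth_map_vec_atlas_iff smooth_on_def by blast+
    then have "higher_differentiable_on T (\<lambda>t. ?\<phi> (c1 t)) n"
      "higher_differentiable_on T (\<lambda>t. ?\<psi> (c2 t)) n"
      by (auto elim!: higher_differentiable_on_subset simp: T_def)
    then have pair: "higher_differentiable_on T (\<lambda>t. (?\<phi> (c1 t), ?\<psi> (c2 t))) n"
      by (rule higher_differentiable_on_Pair[OF T(1)])
    let ?S = "{z \<in> ?\<phi> ` ?U \<times> ?\<psi> ` ?V.
      (\<lambda>(x, y). x \<otimes> y) (inv_into ?U ?\<phi> (fst z), inv_into ?V ?\<psi> (snd z)) \<in> W}"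
    have invs: "inv_into ?U ?\<phi> (?\<phi> (c1 t)) = c1 t" "inv_into ?V ?\<psi> (?\<psi> (c2 t)) = c2 t" if "t \<in> T" for t
      using that chartD(3)[OF top U(1)] chartD(3)[OF top V(1)] by (auto simp: T_def)
    have into_S: "(\<lambda>t. (?\<phi> (c1 t), ?\<psi> (c2 t))) ` T \<subseteq> ?S"
      using invs by (auto simp: T_def)
    have "higher_differentiable_on ?S (\<lambda>z. \<theta> ((\<lambda>(x, y). x \<otimes> y)
        (inv_into ?U ?\<phi> (fst z), inv_into ?V ?\<psi> (snd z)))) n"
      using smooth_on_prod_chart[OF top U(1) top V(1) top W smooth_mult] by (simp only: smooth_on_def)
    note higher_differentiable_on_compose[OF fin T(1) into_S this pair]
    then have "higher_differentiable_on T (\<lambda>t. \<theta> (c1 t \<otimes> c2 t)) n"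
      by (rule higher_differentiable_on_cong[OF T(1), rotated]) (simp add: invs)
    with T show "\<exists>T. open T \<and> t0 \<in> T \<and> higher_differentiable_on T (\<lambda>t. \<theta> (c1 t \<otimes> c2 t)) n"
      by blast
  qed
  with cont show ?thesis
    by (auto simp: smooth_map_vec_atlas_iff)
qed

text \<open>The derivative \<open>D\<close> of the multiplication at \<open>(\<one>, \<one>)\<close> is addition: \<open>D (a, 0) = a\<close> and
  \<open>D (0, a) = a\<close> because \<open>x \<otimes> \<one> = x = \<one> \<otimes> x\<close>, and \<open>D\<close> is linear.\<close>

lemma tangent_map_mult_curves:
  fixes c1 c2 :: "real \<Rightarrow> 'g"
  assumes c1: "manifold_differentiable_at vec_atlas (atlas G) c1 0" "c1 0 = \<one>"
    and c2: "manifold_differentiable_at vec_atlas (atlas G) c2 0" "c2 0 = \<one>"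
  shows "tangent_map vec_atlas (atlas G) (\<lambda>t. c1 t \<otimes> c2 t) 0
    = tangent_map vec_atlas (atlas G) c1 0 + tangent_map vec_atlas (atlas G) c2 0"
proof (rule tangent_map_eqI)
  note top = topological_atlas_group
  let ?\<phi> = "coord (atlas G) \<one>" and ?\<phi>' = "coord_inv (atlas G) \<one>"
  let ?U = "fst (chart_at (atlas G) \<one>)"
  note U = chart_at_in_atlas[OF top, of \<one>]
  let ?K = "\<lambda>z. ?\<phi> (?\<phi>' (fst z) \<otimes> ?\<phi>' (snd z))"
  obtain D where D: "(?K has_derivative D) (at (?\<phi> \<one>, ?\<phi> \<one>))"
    using smooth_map_prod_differentiable[OF top top top smooth_mult, of \<one> \<one>]
    by (auto simp: differentiable_def)
  have ev: "\<forall>\<^sub>F u in at (?\<phi> \<one>). u \<in> ?\<phi> ` ?U"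
    using chartD(2)[OF top U(1)] U(2) by (intro eventually_at_in_open') auto
  have id: "((\<lambda>u. u) has_derivative (\<lambda>a. a)) (at (?\<phi> \<one>))"
    by (rule has_derivative_ident)
  have one: "?\<phi>' (?\<phi> \<one>) = \<one>"
    by (rule coord_inv_base[OF top])
  have D1: "D (a, 0) = a" for a
  proof -
    have "((\<lambda>u. (u, ?\<phi> \<one>)) has_derivative (\<lambda>a. (a, 0))) (at (?\<phi> \<one>))"
      by (auto intro!: derivative_eq_intros)
    from has_derivative_compose[OF this D]
    have "((\<lambda>u. ?\<phi> (?\<phi>' u)) has_derivative (\<lambda>a. D (a, 0))) (at (?\<phi> \<one>))"
      by (simp add: one)
    moreover have "((\<lambda>u. ?\<phi> (?\<phi>' u)) has_derivative (\<lambda>a. a)) (at (?\<phi> \<one>))"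
      by (rule has_derivative_transform_eventually[OF id])
        (use ev in \<open>auto elim!: eventually_mono simp: coord_coord_inv one\<close>)
    ultimately show ?thesis
      using has_derivative_unique by metis
  qed
  have D2: "D (0, a) = a" for a
  proof -
    have "((\<lambda>u. (?\<phi> \<one>, u)) has_derivative (\<lambda>a. (0, a))) (at (?\<phi> \<one>))"
      by (auto intro!: derivative_eq_intros)
    from has_derivative_compose[OF this D]
    have "((\<lambda>u. ?\<phi> (?\<phi>' u)) has_derivative (\<lambda>a. D (0, a))) (at (?\<phi> \<one>))"
      by (simp add: one)
    moreover have "((\<lambda>u. ?\<phi> (?\<phi>' u)) has_derivative (\<lambda>a. a)) (at (?\<phi> \<one>))"
      by (rule has_derivative_transform_eventually[OF id])
        (use ev in \<open>auto elim!: eventually_mono simp: coord_coord_inv one\<close>)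
    ultimately show ?thesis
      using has_derivative_unique by metis
  qed
  have D_add: "D (a, b) = a + b" for a b
  proof -
    have "D ((a, 0) + (0, b)) = D (a, 0) + D (0, b)"
      using D by (intro linear_add bounded_linear.linear has_derivative_bounded_linear)
    then show ?thesis
      by (simp add: D1 D2)
  qed
  let ?T1 = "tangent_map vec_atlas (atlas G) c1 0" and ?T2 = "tangent_map vec_atlas (atlas G) c2 0"
  have "((\<lambda>t. ?\<phi> (c1 t)) has_derivative ?T1) (at 0)" "((\<lambda>t. ?\<phi> (c2 t)) has_derivative ?T2) (at 0)"
    using has_derivative_tangent_map[OF c1(1)] has_derivative_tangent_map[OF c2(1)] c1(2) c2(2)
    by (simp_all add: o_def)
  from has_derivative_Pair[OF this]
  have "((\<lambda>t. (?\<phi> (c1 t), ?\<phi> (c2 t))) has_derivative (\<lambda>h. (?T1 h, ?T2 h))) (at 0)" .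
  from has_derivative_compose[OF this, of ?K D]
  have K: "((\<lambda>t. ?\<phi> (?\<phi>' (?\<phi> (c1 t)) \<otimes> ?\<phi>' (?\<phi> (c2 t)))) has_derivative (\<lambda>h. ?T1 h + ?T2 h)) (at 0)"
    using D c1(2) c2(2) by (simp add: D_add)
  have "\<forall>\<^sub>F t in at 0. c1 t \<in> ?U" "\<forall>\<^sub>F t in at 0. c2 t \<in> ?U"
    using c1 c2 chartD(1)[OF top U(1)] U(2)
    by (auto simp: manifold_differentiable_at_def isCont_def intro!: topological_tendstoD)
  then have ev2: "\<forall>\<^sub>F t in at 0. ?\<phi> (?\<phi>' (?\<phi> (c1 t)) \<otimes> ?\<phi>' (?\<phi> (c2 t))) = ?\<phi> (c1 t \<otimes> c2 t)"
    by eventually_elim (simp add: coord_inv_coord[OF top])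
  have "((\<lambda>t. ?\<phi> (c1 t \<otimes> c2 t)) has_derivative (\<lambda>h. ?T1 h + ?T2 h)) (at 0)"
    by (rule has_derivative_transform_eventually[OF K ev2]) (simp_all add: c1 c2 one)
  then show "((coord (atlas G) (c1 0 \<otimes> c2 0) \<circ> (\<lambda>t. c1 t \<otimes> c2 t) \<circ> coord_inv vec_atlas 0)
      has_derivative blinfun_apply (?T1 + ?T2)) (at (coord vec_atlas 0 0))"
    by (simp add: o_def c1 c2 plus_blinfun.rep_eq)
qed

lemma lie_subalgebra_add:
  assumes "\<And>x y. x \<in> K \<Longrightarrow> y \<in> K \<Longrightarrow> x \<otimes> y \<in> K"
    and "\<zeta> \<in> lie_subalgebra G K" "\<eta> \<in> lie_subalgebra G K"
  shows "\<zeta> + \<eta> \<in> lie_subalgebra G K"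
proof -
  note diff = smooth_map_imp_manifold_differentiable_at[OF topological_vec_atlas topological_atlas_group]
  obtain c1 :: "real \<Rightarrow> 'g" where \<zeta>: "\<zeta> = tangent_map vec_atlas (atlas G) c1 0 1"
    and c1: "smooth_map vec_atlas (atlas G) UNIV c1" "c1 0 = \<one>" "range c1 \<subseteq> K"
    using assms(2) unfolding lie_subalgebra_def by blast
  obtain c2 :: "real \<Rightarrow> 'g" where \<eta>: "\<eta> = tangent_map vec_atlas (atlas G) c2 0 1"
    and c2: "smooth_map vec_atlas (atlas G) UNIV c2" "c2 0 = \<one>" "range c2 \<subseteq> K"
    using assms(3) unfolding lie_subalgebra_def by blast
  have "\<zeta> + \<eta> = tangent_map vec_atlas (atlas G) (\<lambda>t. c1 t \<otimes> c2 t) 0 1"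
    by (simp add: tangent_map_mult_curves[OF diff[OF c1(1)] c1(2) diff[OF c2(1)] c2(2)] \<zeta> \<eta>
        blinfun.add_left)
  moreover have "smooth_map vec_atlas (atlas G) UNIV (\<lambda>t. c1 t \<otimes> c2 t)"
    using c1(1) c2(1) by (rule smooth_map_mult_curves)
  moreover have "range (\<lambda>t. c1 t \<otimes> c2 t) \<subseteq> K"
    using c1(3) c2(3) assms(1) by blast
  ultimately show ?thesis
    unfolding lie_subalgebra_def using c1(2) c2(2) by (auto intro!: exI[of _ "\<lambda>t. c1 t \<otimes> c2 t"])
qed

text \<open>The additivity demanded by \<open>dual_space\<close> concerns the functional restricted to the subalgebra, which
  is \<open>undefined\<close> elsewhere; so it hinges on the subalgebra being closed under addition and scaling.\<close>

lemma momentum_map_in_dual_space: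
  assumes "\<And>x y. x \<in> K \<Longrightarrow> y \<in> K \<Longrightarrow> x \<otimes> y \<in> K"
  shows "momentum_map G (lie_subalgebra G K) (a, q) \<in> dual_space (lie_subalgebra G K)"
  using lie_subalgebra_add[OF assms] lie_subalgebra_scale
  by (auto simp: dual_space_def momentum_map_def blinfun.add_right blinfun.scaleR_right)

end

section \<open>Conservation along the discrete flow\<close>

text \<open>One step of the scheme from \<open>a\<close> through the intermediate point \<open>b\<close> to \<open>c\<close>. Both sides equal a pairing
  with \<open>Ad b\<inverse> \<zeta>\<close>, and the momentum equation identifies the two pairings up to the force
  term, which vanishes on the isotropy algebra.\<close>

lemma (in lie_group_representation) momentum_map_midpoint_step:
  fixes \<nu>1 \<nu>2 :: "'e \<Rightarrow>\<^sub>L real"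
  assumes "\<Delta>t \<noteq> 0" and "\<zeta> \<in> lie_subalgebra G (stabilizer G (dual_action G \<rho>) \<alpha>)"
    and step: "(1 / \<Delta>t) *\<^sub>R (Ad_star G (inv a \<otimes> b) \<nu>1 - \<nu>2)
      = diamond G \<rho> v (dual_action G \<rho> (inv b) \<alpha>)"
  shows "Ad_star G (inv b \<otimes> c) \<nu>2 (Ad G (inv c) \<zeta>) = \<nu>1 (Ad G (inv a) \<zeta>)"
proof -
  have ab: "Ad G (inv a) = Ad G (inv a \<otimes> b) o\<^sub>L Ad G (inv b)"
    and bc: "Ad G (inv b) = Ad G (inv b \<otimes> c) o\<^sub>L Ad G (inv c)"
    by (simp_all add: m_assoc flip: Ad_mult)
  have "(1 / \<Delta>t) * (Ad_star G (inv a \<otimes> b) \<nu>1 (Ad G (inv b) \<zeta>) - \<nu>2 (Ad G (inv b) \<zeta>))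
      = diamond G \<rho> v (dual_action G \<rho> (inv b) \<alpha>) (Ad G (inv b) \<zeta>)"
    using arg_cong[OF step, of "\<lambda>\<nu>. blinfun_apply \<nu> (Ad G (inv b) \<zeta>)"]
    by (simp add: blinfun.scaleR_left blinfun.diff_left)
  also have "\<dots> = 0"
    using assms(2) by (simp add: diamond_dual_action_Ad infinitesimal_action_annihilated)
  finally have "Ad_star G (inv a \<otimes> b) \<nu>1 (Ad G (inv b) \<zeta>) = \<nu>2 (Ad G (inv b) \<zeta>)"
    using assms(1) by simp
  moreover have "Ad_star G (inv a \<otimes> b) \<nu>1 (Ad G (inv b) \<zeta>) = \<nu>1 (Ad G (inv a) \<zeta>)"
    by (simp add: Ad_star_def ab)
  moreover have "Ad_star G (inv b \<otimes> c) \<nu>2 (Ad G (inv c) \<zeta>) = \<nu>2 (Ad G (inv b) \<zeta>)"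
    by (simp add: Ad_star_def bc)
  ultimately show ?thesis by simp
qed

theorem proposition5p1:
  fixes G :: "('g::{t2_space,second_countable_topology}, 'e::real_normed_vector) lie_data"
    and \<rho> :: "'g \<Rightarrow> 'v::real_normed_vector \<Rightarrow> 'v"
    and \<alpha>\<^sub>0 :: "'v \<Rightarrow>\<^sub>L real"
    and H :: "'g \<times> ('e \<Rightarrow>\<^sub>L real) \<Rightarrow> real"
    and Hs :: "nat \<Rightarrow> 'g \<times> ('e \<Rightarrow>\<^sub>L real) \<Rightarrow> real"
    and h h_ext :: "('e \<Rightarrow>\<^sub>L real) \<times> ('v \<Rightarrow>\<^sub>L real) \<Rightarrow> real"
    and hs hs_ext :: "nat \<Rightarrow> ('e \<Rightarrow>\<^sub>L real) \<times> ('v \<Rightarrow>\<^sub>L real) \<Rightarrow> real"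
    and N M :: nat and \<Delta>t :: real
    and \<tau> :: "'e \<Rightarrow> 'g" and U :: "'e set"
    and P :: "'w measure" and W :: "nat \<Rightarrow> real \<Rightarrow> 'w \<Rightarrow> real" and \<omega> :: 'w
    and g gt :: "nat \<Rightarrow> 'g" and \<mu>1 \<mu>2 p :: "nat \<Rightarrow> ('e \<Rightarrow>\<^sub>L real)" and \<xi> \<xi>t :: "nat \<Rightarrow> 'e"
  defines "G\<^sub>\<alpha> \<equiv> stabilizer G (dual_action G \<rho>) \<alpha>\<^sub>0"
    and "\<gg>\<^sub>\<alpha> \<equiv> lie_subalgebra G (stabilizer G (dual_action G \<rho>) \<alpha>\<^sub>0)"
    and "Orb \<equiv> orbit G (dual_action G \<rho>) \<alpha>\<^sub>0"
  assumes "lie_group G"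
    and "lie_representation G \<rho>"
    and "smooth_on_cotangent_bundle (atlas G) H"
    and "\<forall>i\<in>{1..N}. smooth_on_cotangent_bundle (atlas G) (Hs i)"
    and "left_invariant G G\<^sub>\<alpha> H"
    and "\<forall>i\<in>{1..N}. left_invariant G G\<^sub>\<alpha> (Hs i)"
    and "is_reduced_hamiltonian G \<rho> \<alpha>\<^sub>0 H h"
    and "\<forall>i\<in>{1..N}. is_reduced_hamiltonian G \<rho> \<alpha>\<^sub>0 (Hs i) (hs i)"
    and "smooth_extension (UNIV \<times> Orb) h h_ext"
    and "\<forall>i\<in>{1..N}. smooth_extension (UNIV \<times> Orb) (hs i) (hs_ext i)"
    and "lie_retraction G \<tau> U"
    and "\<Delta>t > 0" and "M \<ge> 1"
    and "independent_wiener_processes P N W" and "\<omega> \<in> space P"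
    and "midpoint_trajectory G \<rho> \<alpha>\<^sub>0 \<tau> U \<Delta>t M (step_hamiltonian h_ext N hs_ext W \<Delta>t \<omega>)
           g gt \<mu>1 \<mu>2 \<xi> \<xi>t p"
  shows "\<forall>k\<le>M. momentum_map G \<gg>\<^sub>\<alpha> (g k, p k)
                 = inclusion_dual \<gg>\<^sub>\<alpha> (cotangent_right G (inv\<^bsub>G\<^esub> (g k)) (g k) (p k))
              \<and> momentum_map G \<gg>\<^sub>\<alpha> (g k, p k) \<in> dual_space \<gg>\<^sub>\<alpha>
              \<and> momentum_map G \<gg>\<^sub>\<alpha> (g k, p k) = momentum_map G \<gg>\<^sub>\<alpha> (g 0, p 0)"
proof (intro allI impI conjI)
  interpret lie_group_representation G \<rho>
    by (intro lie_group_representation.intro lie_group_representation_axioms.intro) fact+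
  interpret midpoint_trajectory G \<rho> \<alpha>\<^sub>0 \<tau> U \<Delta>t M "step_hamiltonian h_ext N hs_ext W \<Delta>t \<omega>"
      g gt \<mu>1 \<mu>2 \<xi> \<xi>t p
    by fact
  fix k
  show "momentum_map G \<gg>\<^sub>\<alpha> (g k, p k)
      = inclusion_dual \<gg>\<^sub>\<alpha> (cotangent_right G (inv\<^bsub>G\<^esub> (g k)) (g k) (p k))"
    by (rule momentum_map_eq_inclusion_dual)
  show "momentum_map G \<gg>\<^sub>\<alpha> (g k, p k) \<in> dual_space \<gg>\<^sub>\<alpha>"
    unfolding \<open>\<gg>\<^sub>\<alpha> \<equiv> _\<close> using stabilizer_mult_closed by (rule momentum_map_in_dual_space)
  assume "k \<le> M"
  then show "momentum_map G \<gg>\<^sub>\<alpha> (g k, p k) = momentum_map G \<gg>\<^sub>\<alpha> (g 0, p 0)"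
  proof (induction k)
    case 0
    then show ?case by simp
  next
    case (Suc k)
    let ?\<nu>1 = "dtau_inv_dual G \<tau> U (\<Delta>t *\<^sub>R \<xi>t (Suc k)) (\<mu>1 (Suc k))"
    let ?\<nu>2 = "dtau_inv_dual G \<tau> U (\<Delta>t *\<^sub>R \<xi> (Suc k)) (\<mu>2 (Suc k))"
    have k: "Suc k \<in> {1..M}" "k \<in> {0..M - 1}"
      using Suc.prems by auto
    \<comment> \<open>Here the scheme's \<open>\<tau>\<inverse>\<close> is undone, which is possible as its arguments lie in \<open>\<tau> ` U\<close>.\<close>
    have \<tau>t: "\<tau> (\<Delta>t *\<^sub>R \<xi>t (Suc k)) = inv\<^bsub>G\<^esub> (g k) \<otimes>\<^bsub>G\<^esub> gt (Suc k)"
      using xit[OF k(1)] by (simp add: f_inv_into_f)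
    have \<tau>: "\<tau> (\<Delta>t *\<^sub>R \<xi> (Suc k)) = inv\<^bsub>G\<^esub> (gt (Suc k)) \<otimes>\<^bsub>G\<^esub> g (Suc k)"
      using xi[OF k(1)] by (simp add: f_inv_into_f)
    \<comment> \<open>\<open>p k\<close> is used in its form before the step and \<open>p (Suc k)\<close> in its form after the step, so both are
      expressed by the unknowns of the same step.\<close>
    note step = momentum_map_midpoint_step[OF _ _ momentum_eq[OF k(1), unfolded \<tau>t]]
    have "momentum_map G \<gg>\<^sub>\<alpha> (g (Suc k), p (Suc k)) = momentum_map G \<gg>\<^sub>\<alpha> (g k, p k)"
      unfolding p_after[OF k(1)] p_before[OF k(2)] momentum_map_left_translate \<tau>
      using step \<open>\<Delta>t > 0\<close> unfolding \<open>\<gg>\<^sub>\<alpha> \<equiv> _\<close> by (intro restrict_ext) simp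
    with Suc show ?case by simp
  qed
qed

end
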